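(* Let $\phi(s)=c_0s+\varphi(s)$, with $c_0\ge1$ an integer and $\varphi\in\mathcal{D}$, be analytic on $\mathbb{C}_+$ (i.e. extend analytically to $\mathbb C_+$) and such that $\phi(\mathbb{C}_+)\subseteq\mathbb{C}_\varepsilon$ for some $\varepsilon>0$. Then $C_\phi(\mathcal{H}_+)\subseteq\mathcal{H}^p$ for every $1\le p<\infty$.
   Context: For $\sigma\in\mathbb{R}$, $\mathbb{C}_\sigma=\{s\in\mathbb{C}:\operatorname{Re}s>\sigma\}$ and $\mathbb{C}_+=\mathbb{C}_0$. $\mathcal{D}$ is the space of Dirichlet series that converge at some point of $\mathbb{C}$. For $1\le p<\infty$, $\mathcal{H}^p$ is the completion of the Dirichlet polynomials under the norm $\big\|\sum_{n=1}^Na_nn^{-s}\big\|_p=\lim_{R\to\infty}\big(\frac1{2R}\int_{-R}^R\big|\sum_{n=1}^Na_nn^{-it}\big|^pdt\big)^{1/p}$; its elements are identified with Dirichlet series through their coefficients. $\mathcal{H}_{+}$ is the space of Dirichlet series $D=\sum a_nn^{-s}$ with $\sum_n|a_n|^2n^{-2\sigma}<\infty$ for every $\sigma>0$ (equivalently, $\sum \frac{a_n}{n^\sigma}n^{-s}\in\mathcal{H}^p$ for every $\sigma>0$, for one or every $1\le p<\infty$); each such series converges absolutely on $\mathbb{C}_{\frac12}$. $C_\phi(D)=D\circ\phi$, which for $D\in\mathcal H_+$ is represented on some half-plane by a Dirichlet series; $C_\phi(\mathcal{H}_+)\subseteq\mathcal{H}^p$ means that this Dirichlet series belongs to $\mathcal{H}^p$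 for every $D\in\mathcal{H}_+$. *)

theory Defs
  imports "HOL-Analysis.Analysis"
begin

definition half_plane :: "real \<Rightarrow> complex set" where
  "half_plane \<sigma> = {s. \<sigma> < Re s}"

text \<open>A Dirichlet series is represented by its coefficient sequence \<open>a :: nat \<Rightarrow> complex\<close>,
  of which only the values \<open>a n\<close> with \<open>n \<ge> 1\<close> are used; \<open>a 0\<close> is irrelevant throughout.\<close>

definition dterm :: "(nat \<Rightarrow> complex) \<Rightarrow> complex \<Rightarrow> nat \<Rightarrow> complex" where
  "dterm a s n = a (Suc n) * of_nat (Suc n) powr (- s)"

definition dseries :: "(nat \<Rightarrow> complex) \<Rightarrow> complex \<Rightarrow> complex" where
  "dseries a s = (\<Sum>n. dterm a s n)"

definition convergent_dirichlet :: "(nat \<Rightarrow> complex) set" where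
  "convergent_dirichlet = {a. \<exists>s. summable (dterm a s)}"

definition dirichlet_polynomial :: "(nat \<Rightarrow> complex) \<Rightarrow> bool" where
  "dirichlet_polynomial a \<longleftrightarrow> finite {n. a n \<noteq> 0}"

text \<open>The limit below exists for every Dirichlet polynomial; \<open>dp_norm\<close> is only applied to those.\<close>

definition dp_norm :: "real \<Rightarrow> (nat \<Rightarrow> complex) \<Rightarrow> real" where
  "dp_norm p a = Lim at_top (\<lambda>R::real.
     (1 / (2 * R) * integral {-R..R} (\<lambda>t. norm (dseries a (\<i> * of_real t)) powr p)) powr (1 / p))"

text \<open>The completion of the Dirichlet polynomials, with its elements identified with Dirichlet
  series: an element is given by a Cauchy sequence \<open>P\<close> of Dirichlet polynomials, and its
  \<open>n\<close>-th coefficient is the limit of the \<open>n\<close>-th coefficients of the \<open>P k\<close>.\<close>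

definition hardy :: "real \<Rightarrow> (nat \<Rightarrow> complex) set" where
  "hardy p = {a. \<exists>P :: nat \<Rightarrow> nat \<Rightarrow> complex.
     (\<forall>k. dirichlet_polynomial (P k)) \<and>
     (\<forall>e>0. \<exists>M. \<forall>j\<ge>M. \<forall>k\<ge>M. dp_norm p (\<lambda>n. P j n - P k n) < e) \<and>
     (\<forall>n\<ge>1. (\<lambda>k. P k n) \<longlonglongrightarrow> a n)}"

definition hardy_plus :: "(nat \<Rightarrow> complex) set" where
  "hardy_plus = {a. \<forall>\<sigma>>0.
     summable (\<lambda>n. (norm (a (Suc n)))\<^sup>2 * real (Suc n) powr (- 2 * \<sigma>))}"

text \<open>On some half-plane, \<open>D \<circ> \<phi>\<close> is represented by the Dirichlet series \<open>c\<close>, where \<open>D\<close> is the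
  function defined by the Dirichlet series \<open>a\<close>. Series in \<open>hardy_plus\<close> converge absolutely
  on \<open>half_plane (1/2)\<close>, so \<open>D\<close> is only evaluated where its series converges. The
  coefficients \<open>c n\<close> with \<open>n \<ge> 1\<close> are uniquely determined.\<close>

definition composition_series ::
    "(complex \<Rightarrow> complex) \<Rightarrow> (nat \<Rightarrow> complex) \<Rightarrow> (nat \<Rightarrow> complex) \<Rightarrow> bool" where
  "composition_series \<phi> a c \<longleftrightarrow> (\<exists>\<sigma>\<ge>0. \<forall>s\<in>half_plane \<sigma>.
     \<phi> s \<in> half_plane (1/2) \<and> dterm c s sums dseries a (\<phi> s))"

definition composition_maps_into ::
    "(complex \<Rightarrow> complex) \<Rightarrow> (nat \<Rightarrow> complex) set \<Rightarrow> (nat \<Rightarrow> complex) set \<Rightarrow> bool" where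
  "composition_maps_into \<phi> A B \<longleftrightarrow> (\<forall>a\<in>A. \<exists>c\<in>B. composition_series \<phi> a c)"

end

theory Submission
  imports Defs "HOL-Complex_Analysis.Complex_Analysis"
begin

text \<open>
  Cauchy's theorem on long rectangles shows that a bounded holomorphic function on the right half-plane
  that tends uniformly to \<open>L\<close> as \<open>Re s \<rightarrow> \<infinity>\<close> has mean value \<open>L\<close> on every vertical line; so if its real part
  is nonnegative on some line, then \<open>Re L \<ge> 0\<close>. For a partial sum \<open>f\<close> of \<open>D = \<Sum>a\<^sub>n n\<^sup>-\<^sup>s\<close>, the function \<open>|f|\<^sup>2\<close> is
  dominated on \<open>Re w \<ge> \<epsilon>\<close> by the real part of a bounded holomorphic function \<open>U\<close> that tends to \<open>\<Sum>|a\<^sub>n|\<^sup>2 n\<^sup>-\<^sup>2\<^sup>\<epsilon>\<close>.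
  Since \<open>\<phi>\<close> maps into \<open>Re w > \<epsilon>\<close>, the composition \<open>U \<circ> \<phi>\<close> is again bounded and holomorphic with the same limit
  (this uses \<open>c\<^sub>0 \<ge> 1\<close>), and a Bessel argument bounds the coefficients \<open>c\<^sub>k\<close> of \<open>D \<circ> \<phi>\<close> by
  \<open>\<Sum>|c\<^sub>k|\<^sup>2 \<le> \<Sum>|a\<^sub>n|\<^sup>2 n\<^sup>-\<^sup>2\<^sup>\<epsilon> < \<infinity>\<close>.

  By the divisor bound, the space of the series \<open>D\<close> is closed under products, so the same holds for every power
  \<open>(D \<circ> \<phi>)\<^sup>q = D\<^sup>q \<circ> \<phi>\<close>. Multiplying the coefficients by completely multiplicative summable weights in \<open>[0, 1]\<close> and truncating
  gives Dirichlet polynomials that converge to \<open>D \<circ> \<phi>\<close> in the norm for \<open>p = 2\<close> and are bounded in the norm for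
  \<open>p = 2q\<close>, for each \<open>q\<close>; interpolating between the two gives convergence for every \<open>p\<close>.
\<close>

section \<open>Mean values on vertical lines\<close>

text \<open>Along this filter \<open>Re s\<close> tends to infinity uniformly in
  \<open>Im s\<close>; comparing averages on two vertical lines relies on that uniformity.\<close>

abbreviation far_right :: "complex filter" where
  "far_right \<equiv> filtercomap Re at_top"

text \<open>Continuity is part of the notion, so every integral over \<open>{-R..R}\<close> exists
  and means can be added and compared.\<close>

definition has_mean :: "(real \<Rightarrow> 'a::euclidean_space) \<Rightarrow> 'a \<Rightarrow> bool" where
  "has_mean f L \<longleftrightarrow> continuous_on UNIV f \<and>
     ((\<lambda>R. (1 / (2 * R)) *\<^sub>R integral {-R..R} f) \<longlongrightarrow> L) at_top"

lemma norm_of_nat_powr: "norm (of_nat n powr s :: complex) = real n powr Re s"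
  using norm_powr_real_powr[of "complex_of_nat n" s] by (simp add: in_Reals_norm)

lemma eventually_far_right_ge: "eventually (\<lambda>s. Re s \<ge> x) far_right"
  by (rule eventually_filtercomapI[OF eventually_ge_at_top])

text \<open>Integrals over \<open>{-R..R}\<close> along two vertical lines differ by two horizontal
  sides whose bound does not depend on \<open>R\<close>. After division by \<open>2 * R\<close>
  these vanish, and on a line far to the right the integrand is uniformly close to
  \<open>L\<close>.\<close>

lemma mean_vertical_line:
  assumes hol: "F holomorphic_on half_plane 0"
    and bd: "\<And>s. s \<in> half_plane 0 \<Longrightarrow> norm (F s) \<le> B"
    and lim: "(F \<longlongrightarrow> L) far_right"
    and "\<delta> > 0"
  shows "has_mean (\<lambda>t. F (Complex \<delta> t)) L"
proof -
  have cv: "convex (half_plane 0)" "open (half_plane 0)"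
    by (auto simp: half_plane_def convex_halfspace_Re_gt open_halfspace_Re_gt)
  \<comment> \<open>On the convex half-plane a primitive takes the place of contour integration
    around the rectangle.\<close>
  obtain G where G: "\<And>s. s \<in> half_plane 0 \<Longrightarrow> (G has_field_derivative F s) (at s)"
    using holomorphic_convex_primitive'[OF cv hol] cv(2)
    by (metis at_within_open)
  have ftc: "((\<lambda>t. F (Complex x t)) has_integral (G (Complex x R) - G (Complex x (-R))) / \<i>) {-R..R}"
    if "x > 0" "R \<ge> 0" for x R
  proof -
    have "((\<lambda>t. \<i> * F (Complex x t)) has_integral (G (Complex x R) - G (Complex x (-R)))) {-R..R}"
    proof (rule fundamental_theorem_of_calculus)
      show "-R \<le> R" using that by simp
      fix t assume "t \<in> {-R..R}"
      have 1: "(Complex x has_vector_derivative \<i>) (at t within {-R..R})"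
        unfolding Complex_eq by (auto intro!: derivative_eq_intros)
      show "((\<lambda>t. G (Complex x t)) has_vector_derivative \<i> * F (Complex x t)) (at t within {-R..R})"
        using field_vector_diff_chain_within[OF 1, of G "F (Complex x t)"]
          has_field_derivative_at_within[OF G[of "Complex x t"]] that
        by (auto simp: half_plane_def o_def)
    qed
    from has_integral_mult_right[OF this, of "1/\<i>"] show ?thesis by simp
  qed
  have horiz: "norm (G (Complex x t) - G (Complex y t)) \<le> B * \<bar>x - y\<bar>" if "x > 0" "y > 0" for x y t
  proof -
    have "norm (G (Complex x t) - G (Complex y t)) \<le> B * norm (Complex x t - Complex y t)"
      using field_differentiable_bound[OF cv(1), of G F B "Complex x t" "Complex y t"] G bd that
      by (simp add: half_plane_def has_field_derivative_at_within)
    also have "norm (Complex x t - Complex y t) = \<bar>x - y\<bar>" by (simp add: cmod_def)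
    finally show ?thesis .
  qed
  have cont: "continuous_on UNIV (\<lambda>t. F (Complex \<delta> t))"
  proof (rule continuous_on_compose2[of "half_plane 0" F])
    show "continuous_on UNIV (\<lambda>t. Complex \<delta> t)"
      by (rule continuous_on_Complex) auto
  qed (use holomorphic_on_imp_continuous_on[OF hol] \<open>\<delta> > 0\<close> in \<open>auto simp: half_plane_def\<close>)
  show ?thesis unfolding has_mean_def tendsto_iff
  proof (intro conjI cont allI impI)
    fix e :: real assume e: "e > 0"
    have "eventually (\<lambda>s. norm (F s - L) < e/2) far_right"
      using lim e unfolding tendsto_iff dist_norm by (meson half_gt_zero)
    then obtain x0 where x0: "\<And>s. Re s \<ge> x0 \<Longrightarrow> norm (F s - L) < e/2"
      unfolding eventually_filtercomap eventually_at_top_linorder by blast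
    \<comment> \<open>On the line \<open>Re s = x\<close> the integrand is within \<open>e/2\<close>
      of \<open>L\<close>; the maximum keeps that line from lying to the left of
      \<open>\<delta>\<close>.\<close>
    define x where "x = max x0 \<delta>"
    have x: "x > 0" "x \<ge> \<delta>" using \<open>\<delta>>0\<close> by (auto simp: x_def)
    have B: "B \<ge> 0" using bd[of "Complex x 0"] x by (smt (verit) norm_ge_zero half_plane_def complex.sel mem_Collect_eq)
    \<comment> \<open>Past this threshold the horizontal sides contribute less than
      \<open>e * R\<close>, half of the allowed error \<open>e * (2 * R)\<close>.\<close>
    have ev: "eventually (\<lambda>R. R > 2 * B * (x - \<delta>) / e) at_top" "eventually (\<lambda>R::real. R > 0) at_top"
      by (rule eventually_gt_at_top)+
    show "eventually (\<lambda>R. dist ((1 / (2 * R)) *\<^sub>R integral {-R..R} (\<lambda>t. F (Complex \<delta> t))) L < e) at_top"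
      using ev
    proof eventually_elim
      fix R :: real assume R: "R > 2 * B * (x - \<delta>) / e" "R > 0"
      let ?I = "\<lambda>x. integral {-R..R} (\<lambda>t. F (Complex x t))"
      have I: "?I y = (G (Complex y R) - G (Complex y (-R))) / \<i>" if "y > 0" for y
        using ftc[of y R] that R by auto
      have "?I \<delta> - ?I x = ((G (Complex \<delta> R) - G (Complex x R)) - (G (Complex \<delta> (-R)) - G (Complex x (-R)))) / \<i>"
        unfolding I[OF \<open>\<delta>>0\<close>] I[OF x(1)] by (simp add: algebra_simps)
      then have "norm (?I \<delta> - ?I x) \<le> norm (G (Complex \<delta> R) - G (Complex x R)) + norm (G (Complex \<delta> (-R)) - G (Complex x (-R)))"
        by (simp only: norm_divide norm_ii div_by_1 norm_triangle_ineq4)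
      also have "\<dots> \<le> 2 * B * (x - \<delta>)"
        using horiz[of \<delta> x R] horiz[of \<delta> x "-R"] x \<open>\<delta>>0\<close> by auto
      finally have d1: "norm (?I \<delta> - ?I x) \<le> 2 * B * (x - \<delta>)" .
      have "((\<lambda>t. F (Complex x t) - L) has_integral (?I x - (2*R) *\<^sub>R L)) {-R..R}"
        using has_integral_diff[OF integrable_integral[OF has_integral_integrable[OF ftc[of x R]]]
            has_integral_const_real[of L "-R" R]] x R by simp
      then have "norm (?I x - (2*R) *\<^sub>R L) \<le> e/2 * measure lborel {-R..R}"
        using x0 e by (rule_tac has_integral_bound_real[of "e/2" "{}"]) (auto simp: x_def less_imp_le)
      then have d2: "norm (?I x - (2*R) *\<^sub>R L) \<le> e/2 * (2*R)"
        using R by simp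
      have "norm (?I \<delta> - (2*R) *\<^sub>R L) \<le> 2*B*(x-\<delta>) + e * R"
        using norm_triangle_ineq[of "?I \<delta> - ?I x" "?I x - (2*R) *\<^sub>R L"] d1 d2 by simp
      also have "\<dots> < e * (2*R)" using R e by (simp add: field_simps)
      finally have *: "norm (?I \<delta> - (2*R) *\<^sub>R L) < e * (2*R)" .
      have "(1 / (2 * R)) *\<^sub>R ?I \<delta> - L = (1 / (2 * R)) *\<^sub>R (?I \<delta> - (2*R) *\<^sub>R L)"
        unfolding scaleR_diff_right scaleR_scaleR using R by simp
      then have "norm ((1 / (2 * R)) *\<^sub>R ?I \<delta> - L) = (1/(2*R)) * norm (?I \<delta> - (2*R) *\<^sub>R L)"
        using R by (simp only: norm_scaleR) simp
      also have "\<dots> < e" using * R by (simp add: field_simps)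
      finally show "dist ((1 / (2 * R)) *\<^sub>R ?I \<delta>) L < e" by (simp add: dist_norm)
    qed
  qed
qed

text \<open>\<open>L\<close> is the mean of \<open>F\<close> on the line, hence a limit of averages
  with nonnegative real part. This turns an inequality on a single vertical line into one between
  limits at \<open>far_right\<close>.\<close>

lemma limit_nonneg_of_line_nonneg:
  assumes hol: "F holomorphic_on half_plane 0"
    and bd: "\<And>s. s \<in> half_plane 0 \<Longrightarrow> norm (F s) \<le> B"
    and lim: "(F \<longlongrightarrow> L) far_right"
    and "\<delta> > 0"
    and pos: "\<And>s. Re s = \<delta> \<Longrightarrow> Re (F s) \<ge> 0"
  shows "Re L \<ge> 0"
proof (rule tendsto_lowerbound[OF tendsto_Re])
  show "((\<lambda>R. (1 / (2 * R)) *\<^sub>R integral {-R..R} (\<lambda>t. F (Complex \<delta> t))) \<longlongrightarrow> L) at_top"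
    using mean_vertical_line[OF assms(1-4)] by (simp add: has_mean_def)
  have int: "(\<lambda>t. F (Complex \<delta> t)) integrable_on {-R..R}" for R
    using mean_vertical_line[OF assms(1-4)] unfolding has_mean_def
    by (intro integrable_continuous_interval) (auto intro: continuous_on_subset)
  show "eventually (\<lambda>R. 0 \<le> Re ((1 / (2 * R)) *\<^sub>R integral {-R..R} (\<lambda>t. F (Complex \<delta> t)))) at_top"
    using eventually_gt_at_top[of 0]
  proof eventually_elim
    case (elim R)
    have "Re (integral {-R..R} (\<lambda>t. F (Complex \<delta> t))) = integral {-R..R} (\<lambda>t. Re (F (Complex \<delta> t)))"
      using integral_linear[OF int bounded_linear_Re] by (simp add: o_def)
    moreover have "integral {-R..R} (\<lambda>t. Re (F (Complex \<delta> t))) \<ge> 0"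
      using integrable_linear[OF int bounded_linear_Re] pos
      by (intro integral_nonneg) (simp_all add: o_def)
    ultimately show ?case using elim by simp
  qed
qed simp

section \<open>The Bessel inequality\<close>

definition dpoly :: "(nat \<Rightarrow> complex) \<Rightarrow> nat \<Rightarrow> complex \<Rightarrow> complex" where
  "dpoly a N s = (\<Sum>n=1..N. a n * of_nat n powr (- s))"

text \<open>The real part of \<open>majorant a N \<theta>\<close> is the Poisson extension of \<open>|dpoly a N|\<^sup>2\<close> from the line \<open>Re w = \<theta>\<close>
  to the half-plane on its right: the frequencies \<open>ln (m / n)\<close> with \<open>m > n\<close> are kept, those with \<open>m < n\<close> are
  replaced by their conjugates.\<close>

definition majorant :: "(nat \<Rightarrow> complex) \<Rightarrow> nat \<Rightarrow> real \<Rightarrow> complex \<Rightarrow> complex" where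
  "majorant a N \<theta> w = (\<Sum>n=1..N. cnj (a n) * of_nat n powr (w - of_real (2 * \<theta>)) *
     (a n * of_nat n powr (- w) + 2 * (\<Sum>m\<in>{n<..N}. a m * of_nat m powr (- w))))"

text \<open>Summation by parts against a nondecreasing weight. In the application \<open>v n\<close>
  is the squared norm of a tail sum, so the boundary value \<open>v (Suc N)\<close> is 0.\<close>

lemma abel_lower_bound:
  fixes u v :: "nat \<Rightarrow> real"
  assumes "\<And>m n. 1 \<le> m \<Longrightarrow> m \<le> n \<Longrightarrow> u m \<le> u n" "\<And>n. v n \<ge> 0" "N \<ge> 1"
  shows "u 1 * v 1 - u N * v (Suc N) \<le> (\<Sum>n=1..N. u n * (v n - v (Suc n)))"
  using assms(3)
proof (induction N rule: dec_induct)
  case base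
  then show ?case by (simp add: algebra_simps)
next
  case (step N)
  have "u N * v (Suc N) \<le> u (Suc N) * v (Suc N)"
    using assms step by (intro mult_right_mono) auto
  then show ?case using step by (simp add: algebra_simps)
qed

text \<open>With \<open>x\<close> the \<open>n\<close>-th term and \<open>y\<close> the sum of the
  later ones, \<open>Re (cnj x * (x + 2 * y))\<close> equals
  \<open>(norm (x + y))\<^sup>2 - (norm y)\<^sup>2\<close>. So the real part is a weighted
  telescoping sum.\<close>

lemma majorant_Re:
  defines "S \<equiv> \<lambda>a N w n. \<Sum>m\<in>{n..N::nat}. a m * of_nat m powr (- w) :: complex"
  shows "Re (majorant a N \<theta> w) =
    (\<Sum>n=1..N. real n powr (2 * (Re w - \<theta>)) * ((norm (S a N w n))\<^sup>2 - (norm (S a N w (Suc n)))\<^sup>2))"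
  unfolding majorant_def Re_sum
proof (rule sum.cong[OF refl])
  fix n assume n: "n \<in> {1..N}"
  define x where "x = a n * of_nat n powr (- w)"
  define y where "y = S a N w (Suc n)"
  have S: "S a N w n = x + y"
    using n unfolding S_def x_def y_def by (simp add: sum.atLeast_Suc_atMost)
  have y: "(\<Sum>m\<in>{n<..N}. a m * of_nat m powr (- w)) = y"
    unfolding y_def S_def by (rule sum.cong) auto
  \<comment> \<open>Since \<open>w = 2 * Re w - cnj w\<close>, the power splits into a positive
    weight and the conjugate of \<open>of_nat n powr (- w)\<close>.\<close>
  have "w - of_real (2 * \<theta>) = of_real (2 * (Re w - \<theta>)) + - cnj w"
    by (simp add: complex_eq_iff)
  then have "of_nat n powr (w - of_real (2 * \<theta>)) = of_nat n powr of_real (2 * (Re w - \<theta>)) * of_nat n powr (- cnj w)"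
    by (simp only: powr_add)
  also have "of_nat n powr of_real (2 * (Re w - \<theta>)) = complex_of_real (real n powr (2 * (Re w - \<theta>)))"
    using powr_of_real[of "real n" "2 * (Re w - \<theta>)"] by simp
  also have "of_nat n powr (- cnj w) = cnj (of_nat n powr (- w))"
    using cnj_powr[of "of_nat n" "-w"] n by (simp add: complex_nonpos_Reals_iff)
  finally have "cnj (a n) * of_nat n powr (w - of_real (2 * \<theta>)) = of_real (real n powr (2 * (Re w - \<theta>))) * cnj x"
    by (simp add: x_def)
  then have "Re (cnj (a n) * of_nat n powr (w - of_real (2 * \<theta>)) * (x + 2 * y)) =
     real n powr (2 * (Re w - \<theta>)) * Re (cnj x * (x + 2 * y))"
    by (simp add: mult.assoc)
  also have "Re (cnj x * (x + 2 * y)) = (norm (x + y))\<^sup>2 - (norm y)\<^sup>2"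
    unfolding cmod_power2 by (simp add: power2_eq_square algebra_simps)
  finally show "Re (cnj (a n) * of_nat n powr (w - of_real (2 * \<theta>)) *
       (a n * of_nat n powr (- w) + 2 * (\<Sum>m\<in>{n<..N}. a m * of_nat m powr (- w)))) =
      real n powr (2 * (Re w - \<theta>)) * ((norm (S a N w n))\<^sup>2 - (norm (S a N w (Suc n)))\<^sup>2)"
    unfolding y S y_def[symmetric] x_def[symmetric] .
qed

text \<open>To the right of the line the weights are nondecreasing in \<open>n\<close> and start at
  1, so summation by parts leaves at least the square of the full sum.\<close>

lemma dpoly_le_majorant:
  assumes "Re w \<ge> \<theta>"
  shows "(norm (dpoly a N w))\<^sup>2 \<le> Re (majorant a N \<theta> w)"
proof (cases "N = 0")
  case False
  show ?thesis
    unfolding majorant_Re dpoly_def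
    using abel_lower_bound[of "\<lambda>n. real n powr (2 * (Re w - \<theta>))"
        "\<lambda>n. (norm (\<Sum>m\<in>{n..N}. a m * of_nat m powr (- w)))\<^sup>2" N] False assms
    by (simp add: powr_mono2)
qed (simp add: dpoly_def majorant_def)

text \<open>On the line itself all weights are 1 and the differences telescope.\<close>

lemma dpoly_eq_majorant:
  assumes "Re w = \<theta>"
  shows "(norm (dpoly a N w))\<^sup>2 = Re (majorant a N \<theta> w)"
proof -
  have "Re (majorant a N \<theta> w) = (\<Sum>n=1..N. (norm (\<Sum>m\<in>{n..N}. a m * of_nat m powr (- w)))\<^sup>2
      - (norm (\<Sum>m\<in>{Suc n..N}. a m * of_nat m powr (- w)))\<^sup>2)"
    unfolding majorant_Re using assms by (intro sum.cong) auto
  also have "\<dots> = (norm (dpoly a N w))\<^sup>2"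
    unfolding dpoly_def
    using sum_Suc_diff'[of 1 "Suc N" "\<lambda>n. - (norm (\<Sum>m\<in>{n..N}. a m * of_nat m powr (- w)))\<^sup>2"]
    by (simp add: atLeastLessThanSuc_atLeastAtMost)
  finally show ?thesis by simp
qed

text \<open>Separates the constant term from the powers \<open>(n / m) powr w\<close> with
  \<open>n < m\<close>, which are bounded for \<open>Re w \<ge> 0\<close> and decay to the
  right.\<close>

lemma majorant_altdef:
  "majorant a N \<theta> w = (\<Sum>n=1..N. of_real ((norm (a n))\<^sup>2 * real n powr (- 2 * \<theta>)) +
     2 * (\<Sum>m\<in>{n<..N}. cnj (a n) * a m * of_real (real n powr (- 2 * \<theta>)) * (of_nat n powr w * of_nat m powr (- w))))"
  unfolding majorant_def
proof (rule sum.cong[OF refl])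
  fix n assume n: "n \<in> {1..N}"
  have 1: "of_nat n powr (w - of_real (2 * \<theta>)) = of_nat n powr w * complex_of_real (real n powr (- 2 * \<theta>))"
    using powr_add[of "of_nat n" w "of_real (- 2 * \<theta>)"] powr_of_real[of "real n" "- 2 * \<theta>"] by simp
  have 2: "of_nat n powr w * of_nat n powr (- w) = (1::complex)"
    using n by (simp flip: powr_add)
  have "cnj (a n) * (of_nat n powr w * complex_of_real (real n powr (- 2 * \<theta>))) * (a n * of_nat n powr - w)
     = (cnj (a n) * a n) * complex_of_real (real n powr (- 2 * \<theta>)) * (of_nat n powr w * of_nat n powr (- w))"
    by (simp add: mult_ac)
  also have "\<dots> = of_real ((norm (a n))\<^sup>2 * real n powr (- 2 * \<theta>))"
    unfolding 2 complex_norm_square[symmetric] by (simp add: mult.commute[of "cnj _"] flip: complex_norm_square)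
  finally show "cnj (a n) * of_nat n powr (w - of_real (2 * \<theta>)) *
         (a n * of_nat n powr - w + 2 * (\<Sum>m\<in>{n<..N}. a m * of_nat m powr - w)) =
     of_real ((norm (a n))\<^sup>2 * real n powr (- 2 * \<theta>)) +
     2 * (\<Sum>m\<in>{n<..N}. cnj (a n) * a m * of_real (real n powr (- 2 * \<theta>)) * (of_nat n powr w * of_nat m powr (- w)))"
    unfolding 1 distrib_left by (simp add: sum_distrib_left mult_ac)
qed

section \<open>Limits and bounds of the majorant\<close>

lemma ratio_powr_tendsto_0:
  assumes "1 \<le> n" "n < m"
  shows "((\<lambda>w. of_nat n powr w * of_nat m powr (- w) :: complex) \<longlongrightarrow> 0) far_right"
proof -
  have "((\<lambda>x. real n powr x * real m powr (- x)) \<longlongrightarrow> 0) at_top"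
  proof -
    have "ln (real n / real m) < 0" using assms by (simp add: ln_div)
    then have "filterlim (\<lambda>x. ln (real n / real m) * x) at_bot at_top"
      by (intro filterlim_tendsto_neg_mult_at_bot[OF tendsto_const]) (auto simp: filterlim_ident)
    from filterlim_compose[OF exp_at_bot this]
    have "((\<lambda>x. exp (ln (real n / real m) * x)) \<longlongrightarrow> 0) at_top" .
    also have "(\<lambda>x. exp (ln (real n / real m) * x)) = (\<lambda>x. real n powr x * real m powr (- x))"
      using assms by (auto simp: powr_def ln_div algebra_simps exp_diff exp_minus field_simps)
    finally show ?thesis .
  qed
  from filterlim_compose[OF this filterlim_filtercomap[of Re]] show ?thesis
    by (subst tendsto_norm_zero_iff[symmetric]) (simp add: norm_mult norm_of_nat_powr)
qed

text \<open>Only the constant term survives. The map \<open>f\<close> will be the identity or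
  \<open>\<phi>\<close>.\<close>

lemma majorant_tendsto:
  assumes "filterlim f far_right F"
  shows "((\<lambda>z. majorant a N \<theta> (f z)) \<longlongrightarrow> of_real (\<Sum>n=1..N. (norm (a n))\<^sup>2 * real n powr (- 2 * \<theta>))) F"
proof -
  have "((\<lambda>z. majorant a N \<theta> (f z)) \<longlongrightarrow> (\<Sum>n=1..N. of_real ((norm (a n))\<^sup>2 * real n powr (- 2 * \<theta>)) + 2 * (\<Sum>m\<in>{n<..N}. cnj (a n) * a m * of_real (real n powr (- 2 * \<theta>)) * 0))) F"
    unfolding majorant_altdef
    by (intro tendsto_intros filterlim_compose[OF ratio_powr_tendsto_0 assms]) auto
  then show ?thesis by simp
qed

lemma majorant_holomorphic: "majorant a N \<theta> holomorphic_on A"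
  unfolding majorant_def by (intro holomorphic_intros) auto

lemma dpoly_holomorphic: "dpoly a N holomorphic_on A"
  unfolding dpoly_def by (intro holomorphic_intros) auto

lemma dpoly_bounded:
  assumes "Re s \<ge> 0"
  shows "norm (dpoly a N s) \<le> (\<Sum>n=1..N. norm (a n))"
  unfolding dpoly_def
proof (rule sum_norm_le)
  fix n assume "n \<in> {1..N}"
  then have "real n powr - Re s \<le> 1"
    using powr_mono[of "- Re s" 0 "real n"] assms by simp
  then show "norm (a n * of_nat n powr (- s)) \<le> norm (a n)"
    by (simp add: norm_mult norm_of_nat_powr mult_left_le)
qed

lemma majorant_bounded:
  assumes "Re w \<ge> 0" "\<theta> \<ge> 0"
  shows "norm (majorant a N \<theta> w) \<le> (\<Sum>n=1..N. (norm (a n))\<^sup>2 + 2 * (\<Sum>m\<in>{n<..N}. norm (a n) * norm (a m)))"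
  unfolding majorant_altdef
proof (rule sum_norm_le)
  fix n assume n: "n \<in> {1..N}"
  have n1: "real n powr (- 2 * \<theta>) \<le> 1"
    using powr_mono[of "- 2 * \<theta>" 0 "real n"] assms n by simp
  have "norm (\<Sum>m\<in>{n<..N}. cnj (a n) * a m * of_real (real n powr (- 2 * \<theta>)) * (of_nat n powr w * of_nat m powr (- w)))
     \<le> (\<Sum>m\<in>{n<..N}. norm (a n) * norm (a m))"
  proof (rule sum_norm_le)
    fix m assume m: "m \<in> {n<..N}"
    have "real n powr Re w * real m powr - Re w \<le> real m powr Re w * real m powr - Re w"
      using m n assms by (intro mult_right_mono powr_mono2) auto
    also have "\<dots> = 1" using m by (simp flip: powr_add)
    finally have "real n powr (- 2 * \<theta>) * (real n powr Re w * real m powr - Re w) \<le> 1 * 1"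
      using n1 by (intro mult_mono) auto
    then have "norm (a n) * norm (a m) * (real n powr (- 2 * \<theta>) * (real n powr Re w * real m powr - Re w)) \<le> norm (a n) * norm (a m)"
      by (intro mult_left_le) auto
    then show "norm (cnj (a n) * a m * of_real (real n powr (- 2 * \<theta>)) * (of_nat n powr w * of_nat m powr (- w)))
       \<le> norm (a n) * norm (a m)"
      by (simp add: norm_mult norm_of_nat_powr mult.assoc)
  qed
  moreover have "norm (complex_of_real ((norm (a n))\<^sup>2 * real n powr (- 2 * \<theta>))) \<le> (norm (a n))\<^sup>2"
    using n1 by (simp only: norm_of_real) (simp add: mult_left_le)
  ultimately show "norm (complex_of_real ((norm (a n))\<^sup>2 * real n powr (- 2 * \<theta>)) +
     2 * (\<Sum>m\<in>{n<..N}. cnj (a n) * a m * of_real (real n powr (- 2 * \<theta>)) * (of_nat n powr w * of_nat m powr (- w))))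
     \<le> (norm (a n))\<^sup>2 + 2 * (\<Sum>m\<in>{n<..N}. norm (a n) * norm (a m))"
    by (intro order_trans[OF norm_triangle_ineq] add_mono) (auto simp: norm_mult)
qed

text \<open>On \<open>Re s = \<delta>\<close> the nonnegative quantity
  \<open>(norm (h s - dpoly c K s))\<^sup>2\<close> is at most the real part of the holomorphic
  function \<open>Z\<close>, whose limit is \<open>L\<close> minus the sum. The line is shifted by
  \<open>\<delta>\<close> because \<open>h\<close> lives on the open half-plane.\<close>

lemma bessel_shifted:
  assumes h: "h holomorphic_on half_plane 0" "\<And>s. s \<in> half_plane 0 \<Longrightarrow> norm (h s) \<le> B"
    and V: "V holomorphic_on half_plane 0" "\<And>s. s \<in> half_plane 0 \<Longrightarrow> norm (V s) \<le> B'"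
    and le: "\<And>s. s \<in> half_plane 0 \<Longrightarrow> (norm (h s))\<^sup>2 \<le> Re (V s)"
    and L: "(V \<longlongrightarrow> L) far_right"
    and lim: "((\<lambda>s. (h s - dpoly c K s) * of_nat K powr s) \<longlongrightarrow> 0) far_right"
    and "\<delta> > 0"
  shows "(\<Sum>k=1..K. (norm (c k))\<^sup>2 * real k powr (- 2 * \<delta>)) \<le> Re L"
proof -
  define r where "r = (\<lambda>s. h s - dpoly c K s)"
  \<comment> \<open>For \<open>Re s = \<delta>\<close> the conjugate of
    \<open>of_nat k powr (- s)\<close> is
    \<open>of_nat k powr (- of_real (2 * \<delta>)) * of_nat k powr s\<close>, so the last sum is a
    holomorphic substitute for \<open>r s * cnj (dpoly c K s)\<close>.\<close>
  define Z where "Z = (\<lambda>s. V s - majorant c K \<delta> s -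
     2 * (\<Sum>k=1..K. cnj (c k) * of_nat k powr (- of_real (2 * \<delta>)) * (r s * of_nat k powr s)))"
  \<comment> \<open>For \<open>Re s \<ge> 0\<close> the power with base \<open>K\<close> is the
    largest, so its decay gives that for every \<open>k \<le> K\<close>.\<close>
  have r0: "((\<lambda>s. r s * of_nat k powr s) \<longlongrightarrow> 0) far_right" if k: "k \<in> {1..K}" for k
  proof (rule Lim_null_comparison)
    show "((\<lambda>s. norm (r s * of_nat K powr s)) \<longlongrightarrow> 0) far_right"
      using lim unfolding r_def by (simp add: tendsto_norm_zero)
    show "eventually (\<lambda>s. norm (r s * of_nat k powr s) \<le> norm (r s * of_nat K powr s)) far_right"
      using eventually_far_right_ge[of 0]
    proof eventually_elim
      case (elim s)
      then have "real k powr Re s \<le> real K powr Re s" using k by (intro powr_mono2) auto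
      then show ?case by (simp add: norm_mult norm_of_nat_powr mult_left_mono)
    qed
  qed
  have rB: "\<exists>C. \<forall>s\<in>half_plane 0. norm (r s * of_nat k powr s) \<le> C" if k: "k \<in> {1..K}" for k
  proof -
    have "eventually (\<lambda>s. norm (r s * of_nat k powr s) < 1) far_right"
      by (rule order_tendstoD(2)[OF tendsto_norm_zero[OF r0[OF k]]]) simp
    then obtain x0 where x0: "\<And>s. Re s \<ge> x0 \<Longrightarrow> norm (r s * of_nat k powr s) < 1"
      unfolding eventually_filtercomap eventually_at_top_linorder by blast
    \<comment> \<open>The limit gives the bound 1 beyond \<open>x0\<close>; to the left,
      \<open>real k powr Re s\<close> is at most \<open>real k powr x0\<close>.\<close>
    have "norm (r s * of_nat k powr s) \<le> 1 + (B + (\<Sum>n=1..K. norm (c n))) * real k powr x0"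
      if s: "s \<in> half_plane 0" for s
    proof -
      have rs: "norm (r s) \<le> B + (\<Sum>n=1..K. norm (c n))"
        unfolding r_def using h(2)[OF s] dpoly_bounded[of s c K] s
        by (intro order_trans[OF norm_triangle_ineq4] add_mono) (auto simp: half_plane_def)
      then have p: "B + (\<Sum>n=1..K. norm (c n)) \<ge> 0" by (smt (verit) norm_ge_zero)
      show ?thesis
      proof (cases "Re s \<ge> x0")
        case True
        have "(B + (\<Sum>n=1..K. norm (c n))) * real k powr x0 \<ge> 0" using p by simp
        then show ?thesis using x0[OF True] by linarith
      next
        case False
        then have "norm (r s * of_nat k powr s) \<le> (B + (\<Sum>n=1..K. norm (c n))) * real k powr x0"
          unfolding norm_mult norm_of_nat_powr using rs k p by (intro mult_mono powr_mono) auto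
        then show ?thesis by linarith
      qed
    qed
    then show ?thesis by blast
  qed
  then obtain C where C: "\<And>k s. k \<in> {1..K} \<Longrightarrow> s \<in> half_plane 0 \<Longrightarrow> norm (r s * of_nat k powr s) \<le> C k"
    by metis
  have "Re (L - of_real (\<Sum>k=1..K. (norm (c k))\<^sup>2 * real k powr (- 2 * \<delta>)) - 2 * (\<Sum>k=1..K. cnj (c k) * of_nat k powr (- of_real (2 * \<delta>)) * 0)) \<ge> 0"
  proof (rule limit_nonneg_of_line_nonneg)
    show "Z holomorphic_on half_plane 0"
      unfolding Z_def r_def using h(1) V(1)
      by (intro holomorphic_intros majorant_holomorphic dpoly_holomorphic) auto
    show "(Z \<longlongrightarrow> L - of_real (\<Sum>k=1..K. (norm (c k))\<^sup>2 * real k powr (- 2 * \<delta>)) - 2 * (\<Sum>k=1..K. cnj (c k) * of_nat k powr (- of_real (2 * \<delta>)) * 0)) far_right"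
      unfolding Z_def
      by (intro tendsto_intros L r0 majorant_tendsto[OF filterlim_ident])
    show "norm (Z s) \<le> B' + (\<Sum>n=1..K. (norm (c n))\<^sup>2 + 2 * (\<Sum>m\<in>{n<..K}. norm (c n) * norm (c m)))
      + 2 * (\<Sum>k=1..K. norm (cnj (c k) * of_nat k powr (- of_real (2 * \<delta>))) * C k)"
      if s: "s \<in> half_plane 0" for s
    proof -
      have "norm (\<Sum>k=1..K. cnj (c k) * of_nat k powr (- of_real (2 * \<delta>)) * (r s * of_nat k powr s))
        \<le> (\<Sum>k=1..K. norm (cnj (c k) * of_nat k powr (- of_real (2 * \<delta>))) * C k)"
        by (rule sum_norm_le, subst norm_mult, rule mult_left_mono) (use C s in auto)
      then have "norm (2 * (\<Sum>k=1..K. cnj (c k) * of_nat k powr (- of_real (2 * \<delta>)) * (r s * of_nat k powr s)))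
        \<le> 2 * (\<Sum>k=1..K. norm (cnj (c k) * of_nat k powr (- of_real (2 * \<delta>))) * C k)"
        by (subst norm_mult) simp
      moreover have "norm (majorant c K \<delta> s) \<le> (\<Sum>n=1..K. (norm (c n))\<^sup>2 + 2 * (\<Sum>m\<in>{n<..K}. norm (c n) * norm (c m)))"
        using s \<open>\<delta> > 0\<close> by (intro majorant_bounded) (auto simp: half_plane_def)
      ultimately show ?thesis
        unfolding Z_def using V(2)[OF s]
        by (intro order_trans[OF norm_triangle_ineq4] add_mono) auto
    qed
    show "0 \<le> Re (Z s)" if s: "Re s = \<delta>" for s
    proof -
      have "cnj (dpoly c K s) = (\<Sum>k=1..K. cnj (c k) * of_nat k powr (- cnj s))"
        unfolding dpoly_def cnj_sum
      proof (rule sum.cong[OF refl])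
        fix k assume "k \<in> {1..K}"
        then show "cnj (c k * of_nat k powr - s) = cnj (c k) * of_nat k powr - cnj s"
          using cnj_powr[of "of_nat k" "-s"] by (simp add: complex_nonpos_Reals_iff)
      qed
      also have "- cnj s = - of_real (2 * \<delta>) + s" using s by (simp add: complex_eq_iff)
      finally have "r s * cnj (dpoly c K s) = (\<Sum>k=1..K. cnj (c k) * of_nat k powr (- of_real (2 * \<delta>)) * (r s * of_nat k powr s))"
        unfolding powr_add by (simp only: sum_distrib_left mult_ac)
      then have "Re (Z s) = Re (V s) - (norm (dpoly c K s))\<^sup>2 - 2 * Re (r s * cnj (dpoly c K s))"
        unfolding Z_def dpoly_eq_majorant[OF s] by simp
      also have "Re (V s) \<ge> (norm (h s))\<^sup>2" using le s \<open>\<delta> > 0\<close> by (simp add: half_plane_def)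
      \<comment> \<open>This is the expansion of the squared norm of
        \<open>h s = dpoly c K s + r s\<close>.\<close>
      moreover have "(norm (h s))\<^sup>2 - (norm (dpoly c K s))\<^sup>2 - 2 * Re (r s * cnj (dpoly c K s)) = (norm (r s))\<^sup>2"
        unfolding r_def cmod_power2 by (simp add: power2_eq_square algebra_simps)
      ultimately show ?thesis using zero_le_power2[of "norm (r s)"] by linarith
    qed
  qed fact
  then show ?thesis by simp
qed

text \<open>The shifted sums are finite and continuous in \<open>\<delta>\<close>, so
  \<open>\<delta>\<close> may tend to 0 from the right.\<close>

lemma bessel_inequality:
  assumes h: "h holomorphic_on half_plane 0" "\<And>s. s \<in> half_plane 0 \<Longrightarrow> norm (h s) \<le> B"
    and V: "V holomorphic_on half_plane 0" "\<And>s. s \<in> half_plane 0 \<Longrightarrow> norm (V s) \<le> B'"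
    and le: "\<And>s. s \<in> half_plane 0 \<Longrightarrow> (norm (h s))\<^sup>2 \<le> Re (V s)"
    and L: "(V \<longlongrightarrow> L) far_right"
    and lim: "((\<lambda>s. (h s - dpoly c K s) * of_nat K powr s) \<longlongrightarrow> 0) far_right"
  shows "(\<Sum>k=1..K. (norm (c k))\<^sup>2) \<le> Re L"
proof (rule tendsto_upperbound)
  have "((\<lambda>\<delta>. \<Sum>k=1..K. (norm (c k))\<^sup>2 * real k powr (- 2 * \<delta>)) \<longlongrightarrow> (\<Sum>k=1..K. (norm (c k))\<^sup>2 * real k powr (- 2 * 0))) (at_right 0)"
    by (intro tendsto_intros) auto
  then show "((\<lambda>\<delta>. \<Sum>k=1..K. (norm (c k))\<^sup>2 * real k powr (- 2 * \<delta>)) \<longlongrightarrow> (\<Sum>k=1..K. (norm (c k))\<^sup>2)) (at_right 0)"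
    by simp
  show "eventually (\<lambda>\<delta>. (\<Sum>k=1..K. (norm (c k))\<^sup>2 * real k powr (- 2 * \<delta>)) \<le> Re L) (at_right 0)"
    using eventually_at_right_less[of 0]
    by eventually_elim (rule bessel_shifted[OF assms])
qed simp

section \<open>Absolutely convergent Dirichlet series\<close>

text \<open>Coefficients are summed over all of \<open>UNIV\<close>; the term with index 0 vanishes because \<open>0 powr z = 0\<close>.\<close>

definition drep :: "real \<Rightarrow> real \<Rightarrow> (nat \<Rightarrow> complex) \<Rightarrow> (complex \<Rightarrow> complex) \<Rightarrow> bool" where
  "drep \<sigma> M c g \<longleftrightarrow>
     (\<exists>N\<le>M. ((\<lambda>k. norm (c k) * real k powr - \<sigma>) has_sum N) UNIV) \<and>
     (\<forall>s. Re s \<ge> \<sigma> \<longrightarrow> ((\<lambda>k. c k * of_nat k powr - s) has_sum g s) UNIV)"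

text \<open>Only the values at \<open>k \<ge> 1\<close> are meaningful; at \<open>k = 0\<close> the index set is infinite.\<close>

definition conv :: "(nat \<Rightarrow> complex) \<Rightarrow> (nat \<Rightarrow> complex) \<Rightarrow> nat \<Rightarrow> complex" where
  "conv a b k = (\<Sum>\<^sub>\<infinity>(d, e)\<in>{(d, e). d * e = k}. a d * b e)"

text \<open>Iterated Dirichlet convolution starting from its unit: the coefficients of the
  \<open>q\<close>-th power of the series.\<close>

primrec cpow :: "(nat \<Rightarrow> complex) \<Rightarrow> nat \<Rightarrow> nat \<Rightarrow> complex" where
  "cpow a 0 = (\<lambda>k. if k = 1 then 1 else 0)"
| "cpow a (Suc q) = conv a (cpow a q)"

lemma drep_has_sum: "drep \<sigma> M c g \<Longrightarrow> Re s \<ge> \<sigma> \<Longrightarrow> ((\<lambda>k. c k * of_nat k powr - s) has_sum g s) UNIV"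
  by (simp add: drep_def)

lemma powr_neg_mono:
  assumes "\<sigma> \<le> \<tau>"
  shows "real k powr - \<tau> \<le> real k powr - \<sigma>"
  using assms by (cases "k = 0") (auto intro: powr_mono)

lemma drep_norm_le:
  assumes "drep \<sigma> M c g" "Re s \<ge> \<sigma>"
  shows "norm (g s) \<le> M"
proof -
  obtain N where N: "N \<le> M" "((\<lambda>k. norm (c k) * real k powr - \<sigma>) has_sum N) UNIV"
    using assms unfolding drep_def by blast
  have "norm (g s) \<le> N"
  proof (rule norm_infsum_le[OF drep_has_sum[OF assms] N(2)])
    fix k :: nat
    show "norm (c k * of_nat k powr - s) \<le> norm (c k) * real k powr - \<sigma>"
      using powr_neg_mono[OF assms(2), of k] by (simp add: norm_mult norm_of_nat_powr mult_left_mono)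
  qed
  with N show ?thesis by simp
qed

lemma drep_mono:
  assumes "drep \<sigma> M c g" "\<sigma> \<le> \<sigma>'" "M \<le> M'"
  shows "drep \<sigma>' M' c g"
proof -
  obtain N where N: "N \<le> M" "((\<lambda>k. norm (c k) * real k powr - \<sigma>) has_sum N) UNIV"
    using assms unfolding drep_def by blast
  have le: "norm (c k) * real k powr - \<sigma>' \<le> norm (c k) * real k powr - \<sigma>" for k
    using powr_neg_mono[OF assms(2), of k] by (simp add: mult_left_mono)
  then have s: "(\<lambda>k. norm (c k) * real k powr - \<sigma>') summable_on UNIV"
    using has_sum_imp_summable[OF N(2)] by (rule_tac summable_on_comparison_test) auto
  moreover have "infsum (\<lambda>k. norm (c k) * real k powr - \<sigma>') UNIV \<le> N"
    using has_sum_mono[OF has_sum_infsum[OF s] N(2)] le by simp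
  ultimately show ?thesis
    using assms N unfolding drep_def
    by (meson order_trans has_sum_infsum)
qed

lemma drep_sums:
  assumes "drep \<sigma> M c g" "Re s \<ge> \<sigma>"
  shows "dterm c s sums g s"
proof -
  have "(\<lambda>k. c k * of_nat k powr - s) sums g s"
    by (rule has_sum_imp_sums[OF drep_has_sum[OF assms]])
  then show ?thesis
    unfolding dterm_def by (subst sums_Suc_iff) simp
qed

lemma drep_dseries:
  assumes "(\<lambda>n. norm (a n) * real n powr - \<sigma>) summable_on UNIV"
  shows "\<exists>M. drep \<sigma> M a (dseries a)"
proof -
  define g where "g = (\<lambda>s. \<Sum>\<^sub>\<infinity>n. a n * of_nat n powr - s)"
  have "(\<lambda>n. a n * of_nat n powr - s) summable_on UNIV" if s: "Re s \<ge> \<sigma>" for s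
  proof (rule abs_summable_summable, rule summable_on_comparison_test[OF assms])
    fix n :: nat
    show "norm (a n * of_nat n powr - s) \<le> norm (a n) * real n powr - \<sigma>"
      using powr_neg_mono[OF s, of n] by (simp add: norm_mult norm_of_nat_powr mult_left_mono)
  qed auto
  then have g: "drep \<sigma> (\<Sum>\<^sub>\<infinity>n. norm (a n) * real n powr - \<sigma>) a g"
    unfolding drep_def g_def using has_sum_infsum[OF assms] has_sum_infsum by blast
  have "dseries a s = g s" if "Re s \<ge> \<sigma>" for s
    unfolding dseries_def by (rule sums_unique[symmetric], rule drep_sums[OF g that])
  with g show ?thesis unfolding drep_def by auto
qed

lemma drep_cong:
  assumes "drep \<sigma> M c g" "\<And>s. Re s \<ge> \<sigma> \<Longrightarrow> g s = g' s"
  shows "drep \<sigma> M c g'"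
  using assms unfolding drep_def by auto

text \<open>Absolute convergence lets a sum over \<open>I\<close> be regrouped by the frequency
  \<open>f i\<close>. Products and infinite sums of Dirichlet series both arise in this way.\<close>

lemma drep_pushforward:
  fixes x :: "'i \<Rightarrow> complex" and f :: "'i \<Rightarrow> nat"
  assumes abs: "((\<lambda>i. norm (x i) * real (f i) powr - \<sigma>) has_sum M) I"
    and sum: "\<And>s. Re s \<ge> \<sigma> \<Longrightarrow> ((\<lambda>i. x i * of_nat (f i) powr - s) has_sum g s) I"
  shows "drep \<sigma> M (\<lambda>k. infsum x {i\<in>I. f i = k}) g"
proof -
  define A where "A = (\<lambda>k. {i\<in>I. f i = k})"
  \<comment> \<open>Rewrites \<open>I\<close> as the disjoint union of its fibres over the
    frequencies.\<close>
  have sigma: "((\<lambda>(k, i). h k i) has_sum S) (Sigma UNIV A)"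
    if "((\<lambda>i. h (f i) i) has_sum S) I" for h :: "nat \<Rightarrow> 'i \<Rightarrow> 'b::{comm_monoid_add,topological_space}" and S
    using that
    by (subst has_sum_reindex_bij_witness[of _ "\<lambda>i. (f i, i)" snd I "\<lambda>i. h (f i) i" _ _ S]) (auto simp: A_def)
  \<comment> \<open>Only for \<open>k \<noteq> 0\<close> can the factor
    \<open>real k powr - \<sigma>\<close> be cancelled. Over the fibre of 0 the sum may diverge, but
    there the factor is 0.\<close>
  have nsum: "(\<lambda>i. norm (x i)) summable_on A k" if "k \<noteq> 0" for k
  proof -
    have "(\<lambda>i. norm (x i) * real (f i) powr - \<sigma>) summable_on A k"
      using has_sum_imp_summable[OF abs] by (rule summable_on_subset_banach) (auto simp: A_def)
    also have "?this \<longleftrightarrow> (\<lambda>i. norm (x i) * real k powr - \<sigma>) summable_on A k"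
      by (rule summable_on_cong) (auto simp: A_def)
    finally show ?thesis using that by (subst (asm) summable_on_cmult_left') auto
  qed
  have xsum: "x summable_on A k" if "k \<noteq> 0" for k
    using nsum[OF that] by (rule abs_summable_summable)
  have "((\<lambda>k. infsum x (A k) * of_nat k powr - s) has_sum g s) UNIV" if "Re s \<ge> \<sigma>" for s
  proof (rule has_sum_SigmaD[OF sigma[of "\<lambda>k i. x i * of_nat k powr - s", OF sum[OF that]]])
    fix k :: nat
    show "((\<lambda>i. case (k, i) of (k, i) \<Rightarrow> x i * of_nat k powr - s) has_sum infsum x (A k) * of_nat k powr - s) (A k)"
      using xsum[of k] by (cases "k = 0") (auto intro!: has_sum_cmult_left has_sum_infsum)
  qed
  moreover have nM: "((\<lambda>k. infsum (\<lambda>i. norm (x i)) (A k) * real k powr - \<sigma>) has_sum M) UNIV"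
  proof (rule has_sum_SigmaD[OF sigma[of "\<lambda>k i. norm (x i) * real k powr - \<sigma>", OF abs]])
    fix k :: nat
    show "((\<lambda>i. case (k, i) of (k, i) \<Rightarrow> norm (x i) * real k powr - \<sigma>) has_sum infsum (\<lambda>i. norm (x i)) (A k) * real k powr - \<sigma>) (A k)"
      using nsum[of k] by (cases "k = 0") (auto intro!: has_sum_cmult_left has_sum_infsum)
  qed
  have le: "norm (infsum x (A k)) * real k powr - \<sigma> \<le> infsum (\<lambda>i. norm (x i)) (A k) * real k powr - \<sigma>" for k
    using nsum[of k] by (cases "k = 0") (auto intro!: mult_right_mono norm_infsum_bound)
  have s: "(\<lambda>k. norm (infsum x (A k)) * real k powr - \<sigma>) summable_on UNIV"
    using has_sum_imp_summable[OF nM] le by (rule summable_on_comparison_test) auto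
  moreover have "infsum (\<lambda>k. norm (infsum x (A k)) * real k powr - \<sigma>) UNIV \<le> M"
    using has_sum_mono[OF has_sum_infsum[OF s] nM] le by simp
  ultimately show ?thesis
    unfolding drep_def A_def by (meson has_sum_infsum)
qed

section \<open>Products and infinite sums of absolutely convergent series\<close>

lemma of_nat_mult_powr: "(of_nat (d * e) :: complex) powr z = of_nat d powr z * of_nat e powr z"
  using powr_times_real[of "of_nat d" "of_nat e" z] by simp

lemma has_sum_times:
  fixes f :: "'a \<Rightarrow> complex" and g :: "'b \<Rightarrow> complex"
  assumes "(f has_sum S) A" "(g has_sum T) B"
    and "(\<lambda>x. norm (f x)) summable_on A" "(\<lambda>x. norm (g x)) summable_on B"
  shows "((\<lambda>(x, y). f x * g y) has_sum (S * T)) (A \<times> B)"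
proof (rule has_sum_SigmaI)
  show "((\<lambda>y. case (x, y) of (x, y) \<Rightarrow> f x * g y) has_sum f x * T) B" for x
    using has_sum_cmult_right[OF assms(2)] by simp
  show "((\<lambda>x. f x * T) has_sum S * T) A"
    by (rule has_sum_cmult_left[OF assms(1)])
  have "(\<lambda>z. norm (case z of (x, y) \<Rightarrow> f x * g y)) summable_on (A \<times> B)"
  proof (rule summable_on_SigmaI)
    show "((\<lambda>y. norm (case (x, y) of (x, y) \<Rightarrow> f x * g y)) has_sum norm (f x) * infsum (\<lambda>y. norm (g y)) B) B" for x
      using has_sum_cmult_right[OF has_sum_infsum[OF assms(4)], of "norm (f x)"] by (simp add: norm_mult)
    show "(\<lambda>x. norm (f x) * infsum (\<lambda>y. norm (g y)) B) summable_on A"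
      by (rule summable_on_cmult_left[OF assms(3)])
  qed auto
  then show "(\<lambda>(x, y). f x * g y) summable_on A \<times> B"
    by (rule abs_summable_summable)
qed

lemma drep_abs_summable:
  assumes "drep \<sigma> M c g" "Re s \<ge> \<sigma>"
  shows "(\<lambda>k. norm (c k * of_nat k powr - s)) summable_on UNIV"
proof -
  from drep_mono[OF assms order_refl] show ?thesis
    unfolding drep_def norm_mult norm_of_nat_powr uminus_complex.sel by (auto intro: has_sum_imp_summable)
qed

text \<open>The product of the two sums is absolutely convergent over pairs; regrouping it by
  \<open>d * e\<close> produces the convolution.\<close>

lemma drep_mult:
  assumes "drep \<sigma> M a f" "drep \<sigma> M' b g"
  shows "drep \<sigma> (M * M') (conv a b) (\<lambda>s. f s * g s)"
proof -
  obtain N where N: "N \<le> M" "((\<lambda>k. norm (a k) * real k powr - \<sigma>) has_sum N) UNIV"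
    using assms unfolding drep_def by blast
  obtain N' where N': "N' \<le> M'" "((\<lambda>k. norm (b k) * real k powr - \<sigma>) has_sum N') UNIV"
    using assms unfolding drep_def by blast
  have nonneg: "N \<ge> 0" "N' \<ge> 0"
    using has_sum_nonneg[OF N(2)] has_sum_nonneg[OF N'(2)] by auto
  have "drep \<sigma> (N * N') (\<lambda>k. infsum (\<lambda>(d, e). a d * b e) {i\<in>UNIV \<times> UNIV. (\<lambda>(d, e). d * e) i = k}) (\<lambda>s. f s * g s)"
  proof (rule drep_pushforward)
    fix s assume s: "Re s \<ge> \<sigma>"
    from has_sum_times[OF drep_has_sum[OF assms(1) s] drep_has_sum[OF assms(2) s]
        drep_abs_summable[OF assms(1) s] drep_abs_summable[OF assms(2) s]]
    show "((\<lambda>i. (case i of (d, e) \<Rightarrow> a d * b e) * of_nat (case i of (d, e) \<Rightarrow> d * e) powr - s) has_sum f s * g s) (UNIV \<times> UNIV)"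
      by (simp add: case_prod_unfold of_nat_mult_powr mult_ac del: of_nat_mult)
  next
    \<comment> \<open>\<open>has_sum_times\<close> speaks of complex sums, so the norms pass through
      \<open>of_real\<close>.\<close>
    have "((\<lambda>(d, e). of_real (norm (a d) * real d powr - \<sigma>) * of_real (norm (b e) * real e powr - \<sigma>)) has_sum complex_of_real N * of_real N') (UNIV \<times> UNIV)"
      by (rule has_sum_times) (use N(2) N'(2) in \<open>auto simp: norm_mult intro: has_sum_of_real has_sum_imp_summable simp del: of_real_mult\<close>)
    also have "(\<lambda>(d, e). of_real (norm (a d) * real d powr - \<sigma>) * of_real (norm (b e) * real e powr - \<sigma>)) =
       (\<lambda>i. complex_of_real (norm (case i of (d, e) \<Rightarrow> a d * b e) * real (case i of (d, e) \<Rightarrow> d * e) powr - \<sigma>))"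
      by (auto simp: norm_mult powr_mult)
    finally show "((\<lambda>i. norm (case i of (d, e) \<Rightarrow> a d * b e) * real (case i of (d, e) \<Rightarrow> d * e) powr - \<sigma>) has_sum N * N') (UNIV \<times> UNIV)"
      unfolding of_real_mult[symmetric] has_sum_of_real_iff .
  qed
  moreover have "conv a b = (\<lambda>k. infsum (\<lambda>(d, e). a d * b e) {i\<in>UNIV \<times> UNIV. (\<lambda>(d, e). d * e) i = k})"
    by (auto simp: conv_def fun_eq_iff case_prod_unfold)
  ultimately show ?thesis
    using drep_mono[OF _ order_refl mult_mono[OF N(1) N'(1)]] nonneg N by auto
qed

lemma drep_monomial:
  assumes "n \<ge> 1"
  shows "drep \<sigma> (real n powr - \<sigma>) (\<lambda>k. if k = n then 1 else 0) (\<lambda>s. of_nat n powr - s)"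
  unfolding drep_def
  by (intro conjI exI[of _ "real n powr - \<sigma>"] allI impI has_sum_finite_neutralI[of "{n}"]) auto

lemma drep_cpow:
  assumes "drep \<sigma> M a f"
  shows "drep \<sigma> (M ^ q) (cpow a q) (\<lambda>s. f s ^ q)"
proof (induction q)
  case 0
  show ?case using drep_monomial[of 1 \<sigma>] by simp
qed (use drep_mult[OF assms] in simp)

lemma drep_cmult:
  assumes "drep \<sigma> M a f"
  shows "drep \<sigma> (norm z * M) (\<lambda>k. z * a k) (\<lambda>s. z * f s)"
  unfolding drep_def
proof (intro conjI allI impI)
  obtain N where N: "N \<le> M" "((\<lambda>k. norm (a k) * real k powr - \<sigma>) has_sum N) UNIV"
    using assms unfolding drep_def by blast
  then show "\<exists>N\<le>norm z * M. ((\<lambda>k. norm (z * a k) * real k powr - \<sigma>) has_sum N) UNIV"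
    using has_sum_cmult_right[OF N(2), of "norm z"]
    by (intro exI[of _ "norm z * N"]) (auto simp: norm_mult mult.assoc intro: mult_left_mono)
  fix s assume "Re s \<ge> \<sigma>"
  from has_sum_cmult_right[OF drep_has_sum[OF assms this], of z]
  show "((\<lambda>k. z * a k * of_nat k powr - s) has_sum z * f s) UNIV" by (simp add: mult.assoc)
qed

text \<open>Summable bounds \<open>M i\<close> make the double series over \<open>(i, k)\<close>
  absolutely convergent; regrouping by \<open>k\<close> gives the new coefficients.\<close>

lemma drep_infsum:
  fixes c :: "nat \<Rightarrow> nat \<Rightarrow> complex"
  assumes rep: "\<And>i. drep \<sigma> (M i) (c i) (g i)" and M: "(M has_sum S) UNIV"
  shows "\<exists>c'. drep \<sigma> S c' (\<lambda>s. \<Sum>\<^sub>\<infinity>i. g i s)"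
proof -
  obtain N where N: "\<And>i. N i \<le> M i" "\<And>i. ((\<lambda>k. norm (c i k) * real k powr - \<sigma>) has_sum N i) UNIV"
    using rep unfolding drep_def by metis
  have N0: "N i \<ge> 0" for i using has_sum_nonneg[OF N(2)] by auto
  have Nsum: "N summable_on UNIV"
    using has_sum_imp_summable[OF M] N(1) N0 by (rule summable_on_comparison_test)
  have NS: "infsum N UNIV \<le> S"
    using has_sum_mono[OF has_sum_infsum[OF Nsum] M] N(1) by simp
  have abs: "(\<lambda>(i, k). norm (c i k) * real k powr - \<sigma>) summable_on (UNIV \<times> UNIV)"
    by (rule summable_on_SigmaI[OF _ Nsum]) (use N(2) in auto)
  have "drep \<sigma> (infsum N UNIV) (\<lambda>k. infsum (\<lambda>(i, k). c i k) {i\<in>UNIV \<times> UNIV. snd i = k}) (\<lambda>s. \<Sum>\<^sub>\<infinity>i. g i s)"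
  proof (rule drep_pushforward)
    have "(N has_sum (\<Sum>\<^sub>\<infinity>(i, k)\<in>UNIV \<times> UNIV. norm (c i k) * real k powr - \<sigma>)) UNIV"
      by (rule has_sum_SigmaD[OF has_sum_infsum[OF abs]]) (use N(2) in auto)
    then have "(\<Sum>\<^sub>\<infinity>(i, k)\<in>UNIV \<times> UNIV. norm (c i k) * real k powr - \<sigma>) = infsum N UNIV"
      by (rule infsumI[symmetric])
    then show "((\<lambda>i. norm (case i of (i, k) \<Rightarrow> c i k) * real (snd i) powr - \<sigma>) has_sum infsum N UNIV) (UNIV \<times> UNIV)"
      using has_sum_infsum[OF abs] by (simp add: case_prod_unfold)
  next
    fix s assume s: "Re s \<ge> \<sigma>"
    have "(\<lambda>p. norm (case p of (i, k) \<Rightarrow> c i k * of_nat k powr - s)) summable_on (UNIV \<times> UNIV)"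
      using abs
    proof (rule summable_on_comparison_test)
      fix p :: "nat \<times> nat"
      show "norm (case p of (i, k) \<Rightarrow> c i k * of_nat k powr - s) \<le> (case p of (i, k) \<Rightarrow> norm (c i k) * real k powr - \<sigma>)"
        using powr_neg_mono[OF s, of "snd p"]
        by (auto simp: case_prod_unfold norm_mult norm_of_nat_powr intro!: mult_left_mono)
    qed auto
    then have sm: "(\<lambda>(i, k). c i k * of_nat k powr - s) summable_on (UNIV \<times> UNIV)"
      by (rule abs_summable_summable)
    have "((\<lambda>i. g i s) has_sum (\<Sum>\<^sub>\<infinity>(i, k)\<in>UNIV \<times> UNIV. c i k * of_nat k powr - s)) UNIV"
      by (rule has_sum_SigmaD[OF has_sum_infsum[OF sm]]) (use drep_has_sum[OF rep s] in auto)
    then have "(\<Sum>\<^sub>\<infinity>(i, k)\<in>UNIV \<times> UNIV. c i k * of_nat k powr - s) = (\<Sum>\<^sub>\<infinity>i. g i s)"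
      by (rule infsumI[symmetric])
    then show "((\<lambda>i. (case i of (i, k) \<Rightarrow> c i k) * of_nat (snd i) powr - s) has_sum (\<Sum>\<^sub>\<infinity>i. g i s)) (UNIV \<times> UNIV)"
      using has_sum_infsum[OF sm] by (simp add: case_prod_unfold)
  qed
  from drep_mono[OF this order_refl NS] show ?thesis by blast
qed

section \<open>Composition of Dirichlet series with the symbol\<close>

lemma drep_exp:
  assumes "drep \<sigma> B b f"
  shows "\<exists>c. drep \<sigma> (exp (norm z * B)) c (\<lambda>s. exp (z * f s))"
proof -
  have B0: "B \<ge> 0"
    by (rule order_trans[OF norm_ge_zero drep_norm_le[OF assms, of "of_real \<sigma>"]]) simp
  \<comment> \<open>These are the coefficient norms of the terms of the exponential series, as
    required by \<open>drep_infsum\<close>.\<close>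
  have "((\<lambda>j. norm (z ^ j / fact j) * B ^ j) has_sum exp (norm z * B)) UNIV"
  proof (rule sums_nonneg_imp_has_sum)
    have "(\<lambda>j. (norm z * B) ^ j /\<^sub>R fact j) sums exp (norm z * B)"
      by (rule exp_converges)
    then show "(\<lambda>j. norm (z ^ j / fact j) * B ^ j) sums exp (norm z * B)"
      by (simp add: norm_divide norm_power field_simps)
  qed (use B0 in auto)
  then have "\<exists>c. drep \<sigma> (exp (norm z * B)) c (\<lambda>s. \<Sum>\<^sub>\<infinity>j. z ^ j / fact j * f s ^ j)"
    using drep_cmult[OF drep_cpow[OF assms]] by (rule_tac drep_infsum)
  moreover have "(\<Sum>\<^sub>\<infinity>j. z ^ j / fact j * f s ^ j) = exp (z * f s)" for s
  proof (rule infsumI, rule norm_summable_imp_has_sum)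
    have eq: "z ^ j / fact j * f s ^ j = (z * f s) ^ j /\<^sub>R fact j" for j
      by (auto simp: power_mult_distrib scaleR_conv_of_real field_simps)
    show "summable (\<lambda>j. norm (z ^ j / fact j * f s ^ j))"
      unfolding eq by (rule summable_norm_exp)
    show "(\<lambda>j. z ^ j / fact j * f s ^ j) sums exp (z * f s)"
      unfolding eq by (rule exp_converges)
  qed
  ultimately show ?thesis by simp
qed

text \<open>The power factors as \<open>of_nat (n ^ m) powr (- s)\<close> times
  \<open>exp (- ln n * f s)\<close>. The two norm bounds, \<open>n powr (- m * \<sigma>)\<close> and
  \<open>n powr B\<close>, multiply to the stated one.\<close>

lemma drep_compose_monomial:
  assumes "n \<ge> 1" "drep \<sigma> B b f"
  shows "\<exists>c. drep \<sigma> (real n powr (B - real m * \<sigma>)) c (\<lambda>s. of_nat n powr - (of_nat m * s + f s))"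
proof -
  obtain e where e: "drep \<sigma> (exp (norm (- of_real (ln (real n)) :: complex) * B)) e (\<lambda>s. exp (- of_real (ln (real n)) * f s))"
    using drep_exp[OF assms(2)] by blast
  have n: "n ^ m \<ge> 1" using assms by simp
  have "drep \<sigma> (real n powr (B - real m * \<sigma>)) (conv (\<lambda>k. if k = n ^ m then 1 else 0) e)
     (\<lambda>s. of_nat (n ^ m) powr - s * exp (- of_real (ln (real n)) * f s))"
  proof (rule drep_mono[OF drep_mult[OF drep_monomial[OF n] e] order_refl])
    show "real (n ^ m) powr - \<sigma> * exp (norm (- of_real (ln (real n)) :: complex) * B) \<le> real n powr (B - real m * \<sigma>)"
      using assms by (simp add: powr_def ln_realpow algebra_simps flip: exp_add)
  qed
  then have "drep \<sigma> (real n powr (B - real m * \<sigma>)) (conv (\<lambda>k. if k = n ^ m then 1 else 0) e)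
     (\<lambda>s. of_nat n powr - (of_nat m * s + f s))"
  proof (rule drep_cong)
    fix s
    have "of_nat (n ^ m) powr - s = (exp (- s * of_real (ln (real (n ^ m)))) :: complex)"
      using n by (simp only: powr_def Ln_of_nat) (use assms in simp)
    also have "ln (real (n ^ m)) = real m * ln (real n)"
      using assms by (simp add: ln_realpow)
    finally have "of_nat (n ^ m) powr - s = (exp (- s * of_real (real m * ln (real n))) :: complex)" .
    then show "of_nat (n ^ m) powr - s * exp (- of_real (ln (real n)) * f s) = of_nat n powr - (of_nat m * s + f s)"
      using assms by (simp add: powr_def Ln_of_nat algebra_simps flip: exp_add)
  qed
  then show ?thesis by blast
qed

text \<open>For such large \<open>\<sigma>\<close> the exponent \<open>B - real m * \<sigma>\<close>
  is at most -1, so the composed monomials are dominated by the terms of the series of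
  \<open>a\<close> at 1.\<close>

lemma drep_compose:
  assumes "drep \<sigma> B b f" "m \<ge> 1" "\<sigma> \<ge> 0" "\<sigma> \<ge> B + 1"
    and a: "((\<lambda>n. norm (a n) * real n powr - 1) has_sum M) UNIV"
  shows "\<exists>c. drep \<sigma> M c (\<lambda>s. \<Sum>\<^sub>\<infinity>n. a n * of_nat n powr - (of_nat m * s + f s))"
proof -
  have "\<exists>c. drep \<sigma> (norm (a n) * real n powr - 1) c (\<lambda>s. a n * of_nat n powr - (of_nat m * s + f s))" for n
  proof (cases "n = 0")
    case True
    then show ?thesis by (intro exI[of _ "\<lambda>_. 0"]) (auto simp: drep_def intro: exI[of _ 0])
  next
    case False
    have "B - real m * \<sigma> \<le> -1" using assms mult_right_mono[of 1 "real m" \<sigma>] by simp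
    then have le: "norm (a n) * real n powr (B - real m * \<sigma>) \<le> norm (a n) * real n powr - 1"
      using False by (intro mult_left_mono powr_mono) auto
    have "n \<ge> 1" using False by simp
    from drep_compose_monomial[OF this assms(1)] obtain c
      where "drep \<sigma> (real n powr (B - real m * \<sigma>)) c (\<lambda>s. of_nat n powr - (of_nat m * s + f s))" by blast
    from drep_mono[OF drep_cmult[OF this, of "a n"] order_refl le] show ?thesis by blast
  qed
  then obtain c where "\<And>n. drep \<sigma> (norm (a n) * real n powr - 1) (c n) (\<lambda>s. a n * of_nat n powr - (of_nat m * s + f s))"
    by metis
  from drep_infsum[OF this a] show ?thesis .
qed

text \<open>Against its size at \<open>\<sigma>\<close>, a term with \<open>k > K\<close> gains the
  factor \<open>real k powr (\<sigma> - Re s)\<close>, which is largest at \<open>Suc K\<close>.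
  This decay beats the factor \<open>of_nat K powr s\<close> in the Bessel inequality.\<close>

lemma drep_tail:
  assumes "drep \<sigma> M c g" "Re s \<ge> \<sigma>"
  shows "norm (g s - dpoly c K s) \<le> M * real (Suc K) powr (\<sigma> - Re s)"
proof -
  obtain N where N: "N \<le> M" "((\<lambda>k. norm (c k) * real k powr - \<sigma>) has_sum N) UNIV"
    using assms unfolding drep_def by blast
  define h where "h = (\<lambda>k. if k \<in> {1..K} then c k * of_nat k powr - s else 0)"
  have h: "(h has_sum dpoly c K s) UNIV"
    by (rule has_sum_finite_neutralI[of "{1..K}"]) (auto simp: h_def dpoly_def)
  have "norm (g s - dpoly c K s) \<le> N * real (Suc K) powr (\<sigma> - Re s)"
  proof (rule norm_infsum_le[OF has_sum_add[OF drep_has_sum[OF assms] has_sum_uminusI[OF h], folded diff_conv_add_uminus]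
        has_sum_cmult_left[OF N(2)]])
    fix k
    show "norm (c k * of_nat k powr - s - h k) \<le> norm (c k) * real k powr - \<sigma> * real (Suc K) powr (\<sigma> - Re s)"
    proof (cases "k > K")
      case True
      have "real k powr - Re s = real k powr - \<sigma> * real k powr (\<sigma> - Re s)"
        by (simp flip: powr_add)
      also have "real k powr (\<sigma> - Re s) \<le> real (Suc K) powr (\<sigma> - Re s)"
        using True assms(2) by (intro powr_mono2') auto
      finally have "real k powr - Re s \<le> real k powr - \<sigma> * real (Suc K) powr (\<sigma> - Re s)"
        by (simp add: mult_left_mono)
      then show ?thesis
        using True by (simp add: h_def norm_mult norm_of_nat_powr mult_left_mono mult.assoc)
    qed (cases "k = 0"; simp add: h_def)
  qed
  also have "\<dots> \<le> M * real (Suc K) powr (\<sigma> - Re s)" using N by (intro mult_right_mono) auto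
  finally show ?thesis .
qed

text \<open>The Bessel inequality is applied to \<open>dpoly a K\<close> composed with
  \<open>\<phi>\<close>, which is bounded on the whole half-plane. Cutting \<open>a\<close> at
  \<open>K\<close> changes \<open>D (\<phi> s)\<close> by a multiple of
  \<open>real (Suc K) powr - Re s\<close> far to the right, so the coefficients up to
  \<open>K\<close> are still those of \<open>c\<close>.\<close>

lemma composition_square_summable:
  assumes hol: "\<phi> holomorphic_on half_plane 0" and img: "\<phi> ` half_plane 0 \<subseteq> half_plane \<epsilon>" and "\<epsilon> > 0"
    and lower: "\<And>s. Re s \<ge> \<sigma> \<Longrightarrow> Re (\<phi> s) \<ge> Re s - B"
    and a: "drep 1 A a D"
    and c: "drep \<sigma> M c (\<lambda>s. D (\<phi> s))"
    and S: "\<And>K. (\<Sum>n=1..K. (norm (a n))\<^sup>2 * real n powr (- 2 * \<epsilon>)) \<le> S"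
  shows "(\<Sum>k=1..K. (norm (c k))\<^sup>2) \<le> S"
proof (cases "K = 0")
  case True
  then show ?thesis using S[of 0] by simp
next
  case False
  have Re_pos: "Re (\<phi> s) > \<epsilon>" if "s \<in> half_plane 0" for s
    using img that by (auto simp: half_plane_def)
  have A0: "A \<ge> 0" by (rule order_trans[OF norm_ge_zero drep_norm_le[OF a, of 1]]) simp
  have fl: "filterlim \<phi> far_right far_right"
    unfolding filterlim_filtercomap_iff
  proof (rule filterlim_at_top_mono)
    show "filterlim (\<lambda>s. - B + Re s) at_top far_right"
      by (rule filterlim_tendsto_add_at_top[OF tendsto_const filterlim_filtercomap])
    show "eventually (\<lambda>s. - B + Re s \<le> (Re \<circ> \<phi>) s) far_right"
      using eventually_far_right_ge[of \<sigma>] by eventually_elim (use lower in fastforce)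
  qed
  have lim: "((\<lambda>s. (dpoly a K (\<phi> s) - dpoly c K s) * of_nat K powr s) \<longlongrightarrow> 0) far_right"
  proof (rule Lim_null_comparison)
    \<comment> \<open>The two terms come from the tail of \<open>D\<close> at
      \<open>\<phi> s\<close> and the tail of \<open>c\<close> at \<open>s\<close>, after
      \<open>real (Suc K) powr - Re s\<close> is taken out.\<close>
    let ?C = "A * real (Suc K) powr (1 + B) + M * real (Suc K) powr \<sigma>"
    show "((\<lambda>s. ?C * norm (of_nat K powr s * of_nat (Suc K) powr (- s) :: complex)) \<longlongrightarrow> 0) far_right"
      by (rule tendsto_mult_right_zero[OF tendsto_norm_zero[OF ratio_powr_tendsto_0]]) (use False in auto)
    show "eventually (\<lambda>s. norm ((dpoly a K (\<phi> s) - dpoly c K s) * of_nat K powr s)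
        \<le> ?C * norm (of_nat K powr s * of_nat (Suc K) powr (- s) :: complex)) far_right"
      using eventually_far_right_ge[of \<sigma>] eventually_far_right_ge[of "1 + B"]
    proof eventually_elim
      fix s assume s: "\<sigma> \<le> Re s" "1 + B \<le> Re s"
      have "norm (D (\<phi> s) - dpoly a K (\<phi> s)) \<le> A * real (Suc K) powr (1 - Re (\<phi> s))"
        using lower[OF s(1)] s by (intro drep_tail[OF a]) auto
      also have "\<dots> \<le> A * real (Suc K) powr (1 + B - Re s)"
        using lower[OF s(1)] A0 by (intro mult_left_mono powr_mono) auto
      finally have 1: "norm (dpoly a K (\<phi> s) - D (\<phi> s)) \<le> A * real (Suc K) powr (1 + B) * real (Suc K) powr - Re s"
        by (simp add: norm_minus_commute mult.assoc flip: powr_add)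
      have "norm (D (\<phi> s) - dpoly c K s) \<le> M * real (Suc K) powr (\<sigma> - Re s)"
        by (rule drep_tail[OF c s(1)])
      then have 2: "norm (D (\<phi> s) - dpoly c K s) \<le> M * real (Suc K) powr \<sigma> * real (Suc K) powr - Re s"
        by (simp add: mult.assoc flip: powr_add)
      have "norm (dpoly a K (\<phi> s) - dpoly c K s) \<le> ?C * real (Suc K) powr - Re s"
        using norm_triangle_ineq[of "dpoly a K (\<phi> s) - D (\<phi> s)" "D (\<phi> s) - dpoly c K s"] 1 2
        by (simp add: distrib_right)
      then have "norm (dpoly a K (\<phi> s) - dpoly c K s) * real K powr Re s \<le> ?C * real (Suc K) powr - Re s * real K powr Re s"
        by (rule mult_right_mono) simp
      then show "norm ((dpoly a K (\<phi> s) - dpoly c K s) * of_nat K powr s)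
        \<le> ?C * norm (of_nat K powr s * of_nat (Suc K) powr (- s) :: complex)"
        unfolding norm_mult norm_of_nat_powr uminus_complex.sel by (simp add: mult_ac)
    qed
  qed
  have "(\<Sum>k=1..K. (norm (c k))\<^sup>2) \<le> Re (of_real (\<Sum>n=1..K. (norm (a n))\<^sup>2 * real n powr (- 2 * \<epsilon>)))"
  proof (rule bessel_inequality[OF _ _ _ _ _ majorant_tendsto[OF fl] lim])
    show "(\<lambda>s. dpoly a K (\<phi> s)) holomorphic_on half_plane 0"
      using holomorphic_on_compose_gen[OF hol dpoly_holomorphic[of a K UNIV]] by (simp add: o_def)
    show "(\<lambda>s. majorant a K \<epsilon> (\<phi> s)) holomorphic_on half_plane 0"
      using holomorphic_on_compose_gen[OF hol majorant_holomorphic[of a K \<epsilon> UNIV]] by (simp add: o_def)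
    fix s :: complex assume s: "s \<in> half_plane 0"
    show "norm (dpoly a K (\<phi> s)) \<le> (\<Sum>n=1..K. norm (a n))"
      using Re_pos[OF s] \<open>\<epsilon> > 0\<close> by (intro dpoly_bounded) auto
    show "norm (majorant a K \<epsilon> (\<phi> s)) \<le> (\<Sum>n=1..K. (norm (a n))\<^sup>2 + 2 * (\<Sum>m\<in>{n<..K}. norm (a n) * norm (a m)))"
      using Re_pos[OF s] \<open>\<epsilon> > 0\<close> by (intro majorant_bounded) auto
    show "(norm (dpoly a K (\<phi> s)))\<^sup>2 \<le> Re (majorant a K \<epsilon> (\<phi> s))"
      using Re_pos[OF s] by (intro dpoly_le_majorant) auto
  qed
  with S[of K] show ?thesis by simp
qed

section \<open>Divisor bounds and products\<close>

text \<open>Ordered pairs match the index set of \<open>conv\<close>. For \<open>n \<ge> 1\<close>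
  their number is the number of divisors of \<open>n\<close>; for \<open>n = 0\<close> the set is
  infinite.\<close>

definition factorizations :: "nat \<Rightarrow> (nat \<times> nat) set" where
  "factorizations n = {(d, e). d * e = n}"

lemma factorizations_subset: "n \<ge> 1 \<Longrightarrow> factorizations n \<subseteq> {1..n} \<times> {1..n}"
  unfolding factorizations_def by (auto simp: Suc_le_eq)

lemma finite_factorizations: "n \<ge> 1 \<Longrightarrow> finite (factorizations n)"
  using factorizations_subset finite_subset by blast

text \<open>A divisor of \<open>m * n\<close> is a divisor of \<open>m\<close> times a divisor of
  \<open>n\<close>, so componentwise products of pairs cover all factorizations of
  \<open>m * n\<close>.\<close>

lemma card_factorizations_mult:
  assumes "m \<ge> 1" "n \<ge> 1"
  shows "card (factorizations (m * n)) \<le> card (factorizations m) * card (factorizations n)"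
proof -
  have "factorizations (m * n) \<subseteq> (\<lambda>((d, e), (d', e')). (d * d', e * e')) ` (factorizations m \<times> factorizations n)"
  proof
    fix p assume "p \<in> factorizations (m * n)"
    then obtain d e where p: "p = (d, e)" "d * e = m * n" unfolding factorizations_def by auto
    then obtain d1 d2 where d: "d = d1 * d2" "d1 dvd m" "d2 dvd n"
      using division_decomp[of d m n] by (metis dvd_triv_left)
    then obtain e1 e2 where e: "m = d1 * e1" "n = d2 * e2" by (auto elim!: dvdE)
    have "d1 * d2 * e = d1 * d2 * (e1 * e2)" using p d e by (simp add: mult_ac)
    then have "e = e1 * e2" using assms e by (auto simp: Suc_le_eq)
    then show "p \<in> (\<lambda>((d, e), (d', e')). (d * d', e * e')) ` (factorizations m \<times> factorizations n)"
      using p d e by (intro image_eqI[of _ _ "((d1, e1), (d2, e2))"]) (auto simp: factorizations_def)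
  qed
  then have "card (factorizations (m * n)) \<le> card (factorizations m \<times> factorizations n)"
    using assms by (meson card_image_le card_mono finite_SigmaI finite_factorizations finite_imageI order_trans)
  then show ?thesis by (simp add: card_cartesian_product)
qed

lemma summable_on_factorizations:
  fixes g :: "nat \<times> nat \<Rightarrow> real"
  assumes "g summable_on ({1..} \<times> {1..})"
  shows "(\<lambda>n. \<Sum>p\<in>factorizations n. g p) summable_on {1..}"
proof -
  have "(\<lambda>(n, p). g p) summable_on Sigma {1..} factorizations"
    using assms
    by (subst summable_on_reindex_bij_witness[of _ "\<lambda>p. (fst p * snd p, p)" snd "{1..} \<times> {1..}" g])
       (auto simp: factorizations_def Suc_le_eq)
  from has_sum_SigmaD[OF has_sum_infsum[OF this], of "\<lambda>n. \<Sum>p\<in>factorizations n. g p"]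
  have "((\<lambda>n. \<Sum>p\<in>factorizations n. g p) has_sum (\<Sum>\<^sub>\<infinity>(n, p)\<in>Sigma {1..} factorizations. g p)) {1..}"
    using finite_factorizations by simp
  then show ?thesis by (rule has_sum_imp_summable)
qed

lemma summable_on_times:
  fixes f :: "'a \<Rightarrow> real" and g :: "'b \<Rightarrow> real"
  assumes "f summable_on A" "g summable_on B" "\<And>x. x \<in> A \<Longrightarrow> f x \<ge> 0" "\<And>y. y \<in> B \<Longrightarrow> g y \<ge> 0"
  shows "(\<lambda>p. f (fst p) * g (snd p)) summable_on (A \<times> B)"
proof (rule summable_on_SigmaI)
  show "((\<lambda>y. f (fst (x, y)) * g (snd (x, y))) has_sum f x * infsum g B) B" for x
    using has_sum_cmult_right[OF has_sum_infsum[OF assms(2)]] by simp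
  show "(\<lambda>x. f x * infsum g B) summable_on A"
    by (rule summable_on_cmult_left[OF assms(1)])
qed (use assms in auto)

lemma summable_on_powr:
  assumes "x < -1"
  shows "(\<lambda>n. real n powr x) summable_on A"
proof (rule summable_on_subset_banach[OF summable_nonneg_imp_summable_on])
  show "summable (\<lambda>n. real n powr x)" using assms by (simp add: summable_real_powr_iff)
qed auto

text \<open>Submultiplicativity gives \<open>(\<Sum>n. \<tau> n ^ (j + 1) / n\<^sup>2) \<le> (\<Sum>n. \<tau> n ^ j / n\<^sup>2)\<^sup>2\<close> for the number
  \<open>\<tau> n\<close> of divisors, so that all these sums are finite.\<close>

lemma card_factorizations_moment:
  "(\<lambda>n. real (card (factorizations n)) ^ j * real n powr - 2) summable_on {1..}"
proof (induction j)
  case 0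
  then show ?case using summable_on_powr[of "-2"] by simp
next
  case (Suc j)
  define f where "f = (\<lambda>n. real (card (factorizations n)) ^ j * real n powr - 2)"
  have "(\<lambda>p. f (fst p * snd p)) summable_on ({1..} \<times> {1..})"
  proof (rule summable_on_comparison_test[OF summable_on_times[OF Suc Suc]])
    fix p :: "nat \<times> nat" assume p: "p \<in> {1..} \<times> {1..}"
    have "real (card (factorizations (fst p * snd p))) \<le> real (card (factorizations (fst p))) * real (card (factorizations (snd p)))"
      using card_factorizations_mult[of "fst p" "snd p"] p by (auto simp flip: of_nat_mult)
    then have "real (card (factorizations (fst p * snd p))) ^ j \<le> real (card (factorizations (fst p))) ^ j * real (card (factorizations (snd p))) ^ j"
      unfolding power_mult_distrib[symmetric] by (rule power_mono) simp
    from mult_right_mono[OF this, of "real (fst p) powr - 2 * real (snd p) powr - 2"]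
    show "f (fst p * snd p) \<le> real (card (factorizations (fst p))) ^ j * real (fst p) powr - 2 * (real (card (factorizations (snd p))) ^ j * real (snd p) powr - 2)"
      by (simp add: f_def powr_mult mult_ac)
  qed (auto simp: f_def)
  from summable_on_factorizations[OF this]
  have "(\<lambda>n. \<Sum>p\<in>factorizations n. f (fst p * snd p)) summable_on {1..}" .
  also have "?this \<longleftrightarrow> ?case"
  proof (rule summable_on_cong)
    fix n
    have "(\<Sum>p\<in>factorizations n. f (fst p * snd p)) = (\<Sum>p\<in>factorizations n. f n)"
      by (rule sum.cong) (auto simp: factorizations_def)
    then show "(\<Sum>p\<in>factorizations n. f (fst p * snd p)) = real (card (factorizations n)) ^ Suc j * real n powr - 2"
      by (simp add: f_def mult_ac)
  qed
  finally show ?case .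
qed

text \<open>A term of the convergent moment series is at most its sum, and for
  \<open>j * \<eta> > 2\<close> the \<open>j\<close>-th power of the left side is at most such a
  term. The maximum with 1 ensures \<open>x \<le> x ^ j\<close> in the remaining case.\<close>

lemma card_factorizations_bound:
  assumes "\<eta> > 0"
  obtains C where "\<And>n. n \<ge> 1 \<Longrightarrow> real (card (factorizations n)) * real n powr - \<eta> \<le> C"
proof -
  obtain j :: nat where j: "j * \<eta> > 2" using reals_Archimedean3[OF assms] by blast
  define f where "f = (\<lambda>n. real (card (factorizations n)) ^ j * real n powr - 2)"
  have "real (card (factorizations n)) * real n powr - \<eta> \<le> max 1 (infsum f {1..})" if n: "n \<ge> 1" for n
  proof (rule ccontr)
    define x where "x = real (card (factorizations n)) * real n powr - \<eta>"
    assume "\<not> ?thesis"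
    then have x: "x > 1" "x > infsum f {1..}" by (auto simp: x_def)
    have "j \<noteq> 0" using j by (intro notI) simp
    then have "x \<le> x ^ j" using x by (simp add: self_le_power)
    also have "x ^ j = real (card (factorizations n)) ^ j * real n powr (- (j * \<eta>))"
      unfolding x_def power_mult_distrib using n by (simp add: powr_powr mult.commute flip: powr_realpow)
    also have "\<dots> \<le> f n"
      unfolding f_def using n j by (intro mult_left_mono powr_mono) auto
    also have "f n = sum f {n}" by simp
    also have "\<dots> \<le> infsum f {1..}"
      using card_factorizations_moment[of j] n unfolding f_def by (intro finite_sum_le_infsum) auto
    finally show False using x by simp
  qed
  then show ?thesis using that by blast
qed

lemma hardy_plus_iff:
  "a \<in> hardy_plus \<longleftrightarrow> (\<forall>\<sigma>>0. (\<lambda>n. (norm (a n))\<^sup>2 * real n powr (- 2 * \<sigma>)) summable_on {1..})"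
proof -
  have "summable (\<lambda>n. (norm (a (Suc n)))\<^sup>2 * real (Suc n) powr (- 2 * \<sigma>)) \<longleftrightarrow>
    (\<lambda>n. (norm (a n))\<^sup>2 * real n powr (- 2 * \<sigma>)) summable_on {1..}" for \<sigma>
  proof -
    have "summable (\<lambda>n. (norm (a (Suc n)))\<^sup>2 * real (Suc n) powr (- 2 * \<sigma>)) \<longleftrightarrow>
      (\<lambda>n. (norm (a (Suc n)))\<^sup>2 * real (Suc n) powr (- 2 * \<sigma>)) summable_on UNIV"
      by (subst summable_on_UNIV_nonneg_real_iff) auto
    also have "\<dots> \<longleftrightarrow> (\<lambda>n. (norm (a n))\<^sup>2 * real n powr (- 2 * \<sigma>)) summable_on {1..}"
      by (rule summable_on_reindex_bij_witness[of _ "\<lambda>n. n - 1" Suc]) auto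
    finally show ?thesis .
  qed
  then show ?thesis by (simp add: hardy_plus_def)
qed

section \<open>Closure of \<open>hardy_plus\<close> under products\<close>

lemma conv_eq_sum:
  assumes "n \<ge> 1"
  shows "conv a b n = (\<Sum>p\<in>factorizations n. a (fst p) * b (snd p))"
  using finite_factorizations[OF assms]
  by (simp add: conv_def factorizations_def case_prod_unfold)

text \<open>Cauchy-Schwarz over the factorizations of \<open>n\<close> costs a factor equal to the
  number of divisors. Half of the weight, \<open>real n powr - \<sigma>\<close>, absorbs it; the
  other half splits multiplicatively over \<open>d * e = n\<close>.\<close>

lemma hardy_plus_conv:
  assumes a: "a \<in> hardy_plus" and b: "b \<in> hardy_plus"
  shows "conv a b \<in> hardy_plus"
  unfolding hardy_plus_iff
proof (intro allI impI)
  fix \<sigma> :: real assume \<sigma>: "\<sigma> > 0"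
  obtain C where C: "\<And>n. n \<ge> 1 \<Longrightarrow> real (card (factorizations n)) * real n powr - \<sigma> \<le> C"
    using card_factorizations_bound[OF \<sigma>] by blast
  define f where "f = (\<lambda>n. (norm (a n))\<^sup>2 * real n powr - \<sigma>)"
  define g where "g = (\<lambda>n. (norm (b n))\<^sup>2 * real n powr - \<sigma>)"
  have "f summable_on {1..}" "g summable_on {1..}"
    \<comment> \<open>The condition at \<open>\<sigma>/2\<close> carries exactly the weight
      \<open>real n powr - \<sigma>\<close>.\<close>
    using a b \<sigma> unfolding hardy_plus_iff f_def g_def by (auto dest!: spec[of _ "\<sigma>/2"])
  then have "(\<lambda>p. f (fst p) * g (snd p)) summable_on {1..} \<times> {1..}"
    by (rule summable_on_times) (auto simp: f_def g_def)
  from summable_on_cmult_right[OF summable_on_factorizations[OF this], of C]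
  show "(\<lambda>n. (norm (conv a b n))\<^sup>2 * real n powr (- 2 * \<sigma>)) summable_on {1..}"
  proof (rule summable_on_comparison_test)
    fix n :: nat assume "n \<in> {1..}"
    then have n: "n \<ge> 1" by simp
    define T where "T = (\<Sum>p\<in>factorizations n. (norm (a (fst p)) * norm (b (snd p)))\<^sup>2)"
    have T: "T * real n powr - \<sigma> = (\<Sum>p\<in>factorizations n. f (fst p) * g (snd p))"
      unfolding T_def sum_distrib_right
      by (rule sum.cong) (auto simp: f_def g_def factorizations_def power_mult_distrib powr_mult)
    have "norm (conv a b n) \<le> (\<Sum>p\<in>factorizations n. norm (a (fst p)) * norm (b (snd p)))"
      unfolding conv_eq_sum[OF n] by (rule sum_norm_le) (simp add: norm_mult)
    then have "(norm (conv a b n))\<^sup>2 \<le> (\<Sum>p\<in>factorizations n. norm (a (fst p)) * norm (b (snd p)))\<^sup>2"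
      by (rule power_mono) simp
    also have "\<dots> \<le> T * real (card (factorizations n))"
      unfolding T_def by (rule sum_squared_le_sum_of_squares)
    finally have "(norm (conv a b n))\<^sup>2 * real n powr (- 2 * \<sigma>) \<le> T * real (card (factorizations n)) * (real n powr - \<sigma> * real n powr - \<sigma>)"
      by (simp add: mult_right_mono flip: powr_add)
    also have "\<dots> = (real (card (factorizations n)) * real n powr - \<sigma>) * (T * real n powr - \<sigma>)"
      by simp
    also have "\<dots> \<le> C * (T * real n powr - \<sigma>)"
      using C[OF n] by (rule mult_right_mono) (simp add: T_def sum_nonneg)
    finally show "(norm (conv a b n))\<^sup>2 * real n powr (- 2 * \<sigma>) \<le> C * (\<Sum>p\<in>factorizations n. f (fst p) * g (snd p))"
      unfolding T .
  qed auto
qed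

lemma hardy_plus_cpow:
  assumes "a \<in> hardy_plus"
  shows "cpow a q \<in> hardy_plus"
proof (induction q)
  case 0
  have "(\<lambda>n. (norm (if n = 1 then 1 else 0 :: complex))\<^sup>2 * real n powr (- 2 * \<sigma>)) summable_on {1..}" for \<sigma>
    by (rule finite_nonzero_values_imp_summable_on, rule finite_subset[of _ "{1}"]) auto
  then show ?case by (simp add: hardy_plus_iff)
qed (use hardy_plus_conv[OF assms] in simp)

text \<open>Split \<open>1 = 1/4 + 3/4\<close> in the exponent and use
  \<open>x * y \<le> x\<^sup>2 + y\<^sup>2\<close>: one square is summable by the condition at
  \<open>1/4\<close>, the other is \<open>real n powr - (3/2)\<close>.\<close>

lemma hardy_plus_abs_summable:
  assumes "a \<in> hardy_plus"
  shows "(\<lambda>n. norm (a n) * real n powr - 1) summable_on UNIV"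
proof -
  have "(\<lambda>n. (norm (a n))\<^sup>2 * real n powr (- 2 * (1/4)) + real n powr - (3/2)) summable_on {1..}"
    using assms[unfolded hardy_plus_iff, rule_format, of "1/4"]
    by (intro summable_on_add summable_on_powr) auto
  then have "(\<lambda>n. norm (a n) * real n powr - 1) summable_on {1..}"
  proof (rule summable_on_comparison_test)
    fix n :: nat assume "n \<in> {1..}"
    define x where "x = norm (a n) * real n powr - (1/4)"
    define y where "y = real n powr - (3/4)"
    have "x * y = norm (a n) * real n powr - 1"
      unfolding x_def y_def mult.assoc powr_add[symmetric] by simp
    moreover have "x\<^sup>2 = (norm (a n))\<^sup>2 * real n powr (- 2 * (1/4))" "y\<^sup>2 = real n powr - (3/2)"
      unfolding x_def y_def power_mult_distrib by (simp_all add: power2_eq_square flip: powr_add)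
    moreover have "x * y \<le> x\<^sup>2 + y\<^sup>2"
      using sum_squares_bound[of x y] zero_le_power2[of x] zero_le_power2[of y] by linarith
    ultimately show "norm (a n) * real n powr - 1 \<le> (norm (a n))\<^sup>2 * real n powr (- 2 * (1/4)) + real n powr - (3/2)"
      by simp
  qed auto
  also have "?this \<longleftrightarrow> ?thesis"
    by (rule summable_on_cong_neutral) (auto simp: not_less_eq_eq)
  finally show ?thesis .
qed

section \<open>Mean values of trigonometric polynomials\<close>

lemma has_mean_integrable: "has_mean f L \<Longrightarrow> f integrable_on {a..b}"
  unfolding has_mean_def by (intro integrable_continuous_interval) (auto intro: continuous_on_subset)

lemma has_mean_const: "has_mean (\<lambda>_. c) c"
  unfolding has_mean_def
proof
  have "eventually (\<lambda>R::real. (1 / (2 * R)) *\<^sub>R integral {-R..R} (\<lambda>_. c) = c) at_top"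
    using eventually_gt_at_top[of 0] by eventually_elim simp
  then show "((\<lambda>R. (1 / (2 * R)) *\<^sub>R integral {-R..R} (\<lambda>_. c)) \<longlongrightarrow> c) at_top"
    by (rule tendsto_eventually)
qed simp

lemma has_mean_add:
  assumes "has_mean f L" "has_mean g M"
  shows "has_mean (\<lambda>t. f t + g t) (L + M)"
proof -
  have "(\<lambda>R. (1 / (2 * R)) *\<^sub>R integral {-R..R} (\<lambda>t. f t + g t)) =
     (\<lambda>R. (1 / (2 * R)) *\<^sub>R integral {-R..R} f + (1 / (2 * R)) *\<^sub>R integral {-R..R} g)"
    using has_mean_integrable[OF assms(1)] has_mean_integrable[OF assms(2)]
    by (simp add: integral_add scaleR_add_right)
  with assms show ?thesis
    unfolding has_mean_def by (auto intro: continuous_intros tendsto_add)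
qed

lemma has_mean_linear:
  assumes "has_mean f L" "bounded_linear h"
  shows "has_mean (\<lambda>t. h (f t)) (h L)"
proof -
  have "(\<lambda>R. (1 / (2 * R)) *\<^sub>R integral {-R..R} (\<lambda>t. h (f t))) =
     (\<lambda>R. h ((1 / (2 * R)) *\<^sub>R integral {-R..R} f))"
    using integral_linear[OF has_mean_integrable[OF assms(1)] assms(2)]
    by (simp add: linear_simps[OF assms(2)] o_def)
  with assms show ?thesis
    unfolding has_mean_def
    by (auto intro: bounded_linear.tendsto bounded_linear.continuous_on)
qed

lemma has_mean_cmult:
  fixes c :: "'a::{euclidean_space, real_normed_algebra}"
  shows "has_mean f L \<Longrightarrow> has_mean (\<lambda>t. c * f t) (c * L)"
  by (rule has_mean_linear[OF _ bounded_linear_mult_right])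

lemma has_mean_uminus: "has_mean f L \<Longrightarrow> has_mean (\<lambda>t. - f t) (- L)"
  by (rule has_mean_linear[OF _ bounded_linear_minus[OF bounded_linear_ident]])

lemma has_mean_diff:
  assumes "has_mean f L" "has_mean g M"
  shows "has_mean (\<lambda>t. f t - g t) (L - M)"
  using has_mean_add[OF assms(1) has_mean_uminus[OF assms(2)]] by simp

lemma has_mean_sum:
  assumes "\<And>i. i \<in> I \<Longrightarrow> has_mean (f i) (L i)"
  shows "has_mean (\<lambda>t. \<Sum>i\<in>I. f i t) (\<Sum>i\<in>I. L i)"
  using assms
proof (induction I rule: infinite_finite_induct)
  case (insert i I)
  then show ?case by (simp add: has_mean_add)
qed (simp_all add: has_mean_const)

lemma average_norm_le:
  fixes f :: "real \<Rightarrow> 'a::euclidean_space"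
  assumes "f integrable_on {-R..R}" "\<And>t. norm (f t) \<le> e" "R > 0"
  shows "norm ((1 / (2 * R)) *\<^sub>R integral {-R..R} f) \<le> e"
proof -
  have "e \<ge> 0" using assms(2)[of 0] norm_ge_zero order_trans by blast
  then have "norm (integral {-R..R} f) \<le> e * measure lborel {-R..R}"
    using assms by (intro has_integral_bound_real[of e "{}" f]) (auto intro: integrable_integral)
  then have "norm (integral {-R..R} f) \<le> e * (2 * R)" using assms by simp
  then show ?thesis using assms by (simp add: field_simps)
qed

lemma has_mean_norm_le:
  assumes "has_mean f L" "\<And>t. norm (f t) \<le> e"
  shows "norm L \<le> e"
proof (rule tendsto_upperbound[OF tendsto_norm])
  show "((\<lambda>R. (1 / (2 * R)) *\<^sub>R integral {-R..R} f) \<longlongrightarrow> L) at_top"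
    using assms by (simp add: has_mean_def)
  show "eventually (\<lambda>R. norm ((1 / (2 * R)) *\<^sub>R integral {-R..R} f) \<le> e) at_top"
    using eventually_gt_at_top[of 0]
    by eventually_elim (rule average_norm_le[OF has_mean_integrable[OF assms(1)] assms(2)])
qed simp

lemma has_mean_mono:
  fixes f g :: "real \<Rightarrow> real"
  assumes "has_mean f L" "has_mean g M" "\<And>t. f t \<le> g t"
  shows "L \<le> M"
proof (rule tendsto_le)
  show "((\<lambda>R. (1 / (2 * R)) *\<^sub>R integral {-R..R} f) \<longlongrightarrow> L) at_top"
    "((\<lambda>R. (1 / (2 * R)) *\<^sub>R integral {-R..R} g) \<longlongrightarrow> M) at_top"
    using assms by (simp_all add: has_mean_def)
  show "eventually (\<lambda>R. (1 / (2 * R)) *\<^sub>R integral {-R..R} f \<le> (1 / (2 * R)) *\<^sub>R integral {-R..R} g) at_top"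
    using eventually_gt_at_top[of 0]
  proof eventually_elim
    case (elim R)
    have "integral {-R..R} f \<le> integral {-R..R} g"
      using has_mean_integrable[OF assms(1)] has_mean_integrable[OF assms(2)] assms(3) by (rule integral_le)
    then show ?case using elim by (intro scaleR_left_mono) auto
  qed
qed simp

text \<open>The averages of \<open>f\<close> and \<open>g n\<close> differ by at most
  \<open>e n\<close> for every \<open>R > 0\<close>, so the limits in \<open>R\<close> and in
  \<open>n\<close> may be interchanged.\<close>

lemma has_mean_uniform_limit:
  assumes g: "\<And>n. has_mean (g n) (M n)" and M: "M \<longlonglongrightarrow> L" and e: "e \<longlonglongrightarrow> 0"
    and le: "\<And>n t. norm (f t - g n t) \<le> e n"
  shows "has_mean f L"
  unfolding has_mean_def
proof
  have "uniform_limit UNIV g f sequentially"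
  proof (rule uniform_limitI)
    fix r :: real assume "r > 0"
    then have "eventually (\<lambda>n. e n < r) sequentially" using order_tendstoD(2)[OF e] by blast
    then show "eventually (\<lambda>n. \<forall>x\<in>UNIV. dist (g n x) (f x) < r) sequentially"
      by eventually_elim (use le in \<open>auto simp: dist_norm norm_minus_commute intro: le_less_trans\<close>)
  qed
  then show cont: "continuous_on UNIV f"
    by (rule uniform_limit_theorem[rotated]) (use g in \<open>auto simp: has_mean_def\<close>)
  have int: "f integrable_on {a..b}" for a b
    using cont by (intro integrable_continuous_interval) (auto intro: continuous_on_subset)
  show "((\<lambda>R. (1 / (2 * R)) *\<^sub>R integral {-R..R} f) \<longlongrightarrow> L) at_top"
    unfolding tendsto_iff
  proof (intro allI impI)
    fix r :: real assume "r > 0"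
    then have r: "r / 3 > 0" by simp
    have "eventually (\<lambda>n. e n < r / 3 \<and> dist (M n) L < r / 3) sequentially"
      using order_tendstoD(2)[OF e r] tendstoD[OF M r] by (rule eventually_conj)
    then obtain n where n: "e n < r / 3" "dist (M n) L < r / 3"
      using eventually_happens'[OF sequentially_bot] by blast
    have "eventually (\<lambda>R. dist ((1 / (2 * R)) *\<^sub>R integral {-R..R} (g n)) (M n) < r / 3) at_top"
      using g[of n] unfolding has_mean_def by (intro tendstoD[OF _ r]) simp
    then show "eventually (\<lambda>R. dist ((1 / (2 * R)) *\<^sub>R integral {-R..R} f) L < r) at_top"
      using eventually_gt_at_top[of 0]
    proof eventually_elim
      case (elim R)
      have i: "(\<lambda>t. f t - g n t) integrable_on {-R..R}"
        using int has_mean_integrable[OF g] by (rule integrable_diff)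
      have "norm ((1 / (2 * R)) *\<^sub>R integral {-R..R} (\<lambda>t. f t - g n t)) \<le> e n"
        using average_norm_le[OF i le elim(2)] .
      also have "(1 / (2 * R)) *\<^sub>R integral {-R..R} (\<lambda>t. f t - g n t) =
         (1 / (2 * R)) *\<^sub>R integral {-R..R} f - (1 / (2 * R)) *\<^sub>R integral {-R..R} (g n)"
        using int has_mean_integrable[OF g] by (simp add: integral_diff scaleR_diff_right)
      finally have "dist ((1 / (2 * R)) *\<^sub>R integral {-R..R} f) ((1 / (2 * R)) *\<^sub>R integral {-R..R} (g n)) < r / 3"
        using n by (simp add: dist_norm)
      with elim n show ?case
        using dist_triangle_third[of "(1 / (2 * R)) *\<^sub>R integral {-R..R} f" "(1 / (2 * R)) *\<^sub>R integral {-R..R} (g n)" r "M n" L]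
        by blast
    qed
  qed
qed

text \<open>A mean is bounded by any uniform bound of its function, so the means of ever better
  approximants form a Cauchy sequence.\<close>

lemma has_mean_exists_uniform_limit:
  assumes "\<And>e. e > 0 \<Longrightarrow> \<exists>g M. has_mean g M \<and> (\<forall>t. norm (f t - g t) \<le> e)"
  shows "\<exists>L. has_mean f L"
proof -
  define e :: "nat \<Rightarrow> real" where "e = (\<lambda>n. inverse (real (Suc n)))"
  have e: "e \<longlonglongrightarrow> 0" unfolding e_def by (rule LIMSEQ_inverse_real_of_nat)
  have "\<exists>g M. has_mean g M \<and> (\<forall>t. norm (f t - g t) \<le> e n)" for n
    by (rule assms) (simp add: e_def)
  then obtain g M where g: "\<And>n. has_mean (g n) (M n)" "\<And>n t. norm (f t - g n t) \<le> e n"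
    by metis
  have M: "dist (M m) (M n) \<le> e m + e n" for m n
    unfolding dist_norm
  proof (rule has_mean_norm_le[OF has_mean_diff[OF g(1) g(1)]])
    show "norm (g m t - g n t) \<le> e m + e n" for t
      using g(2)[of t m] g(2)[of t n] norm_triangle_ineq4[of "f t - g n t" "f t - g m t"] by simp
  qed
  have "Cauchy M"
    unfolding Cauchy_def
  proof (intro allI impI)
    fix r :: real assume "r > 0"
    then have "eventually (\<lambda>n. e n < r / 2) sequentially" using order_tendstoD(2)[OF e, of "r / 2"] by simp
    then obtain k where "\<And>n. n \<ge> k \<Longrightarrow> e n < r / 2" unfolding eventually_sequentially by blast
    then show "\<exists>k. \<forall>m\<ge>k. \<forall>n\<ge>k. dist (M m) (M n) < r"
      using M by (intro exI[of _ k] allI impI) (smt (verit) field_sum_of_halves)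
  qed
  then obtain L where "M \<longlonglongrightarrow> L" using Cauchy_convergent convergent_def by blast
  from has_mean_uniform_limit[OF g(1) this e g(2)] show ?thesis by blast
qed

text \<open>An oscillating exponential has a bounded primitive, so its averages are of order
  \<open>1 / R\<close>.\<close>

lemma has_mean_exp:
  assumes "\<omega> \<noteq> 0"
  shows "has_mean (\<lambda>t. exp (\<i> * of_real (\<omega> * t))) 0"
  unfolding has_mean_def
proof
  show "continuous_on UNIV (\<lambda>t. exp (\<i> * of_real (\<omega> * t)))"
    by (intro continuous_intros)
  show "((\<lambda>R. (1 / (2 * R)) *\<^sub>R integral {-R..R} (\<lambda>t. exp (\<i> * of_real (\<omega> * t)))) \<longlongrightarrow> 0) at_top"
  proof (rule Lim_null_comparison)
    show "((\<lambda>R::real. 1 / \<bar>\<omega>\<bar> * (1 / R)) \<longlongrightarrow> 0) at_top"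
      by (intro tendsto_mult_right_zero tendsto_divide_0[OF tendsto_const] filterlim_at_top_imp_at_infinity filterlim_ident)
    show "eventually (\<lambda>R. norm ((1 / (2 * R)) *\<^sub>R integral {-R..R} (\<lambda>t. exp (\<i> * of_real (\<omega> * t)))) \<le> 1 / \<bar>\<omega>\<bar> * (1 / R)) at_top"
      using eventually_gt_at_top[of 0]
    proof eventually_elim
      case (elim R)
      define G where "G = (\<lambda>t. exp (\<i> * of_real (\<omega> * t)) / (\<i> * of_real \<omega>) :: complex)"
      have "((\<lambda>t. exp (\<i> * of_real (\<omega> * t))) has_integral G R - G (-R)) {-R..R}"
      proof (rule fundamental_theorem_of_calculus)
        fix t assume "t \<in> {-R..R}"
        have "((\<lambda>t. \<i> * of_real (\<omega> * t)) has_vector_derivative \<i> * of_real \<omega>) (at t within {-R..R})"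
          by (auto intro!: derivative_eq_intros)
        from field_vector_diff_chain_within[OF this has_field_derivative_at_within[OF DERIV_exp]]
        have "((\<lambda>t. exp (\<i> * of_real (\<omega> * t)) :: complex) has_vector_derivative (\<i> * of_real \<omega>) * exp (\<i> * of_real (\<omega> * t))) (at t within {-R..R})"
          by (simp add: o_def)
        from has_vector_derivative_divide[OF this, of "\<i> * of_real \<omega>"]
        show "(G has_vector_derivative exp (\<i> * of_real (\<omega> * t))) (at t within {-R..R})"
          unfolding G_def using assms by simp
      qed (use elim in simp)
      then have "integral {-R..R} (\<lambda>t. exp (\<i> * of_real (\<omega> * t))) = G R - G (-R)"
        by (rule integral_unique)
      moreover have "norm (G t) = 1 / \<bar>\<omega>\<bar>" for t
        by (simp add: G_def norm_divide norm_mult)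
      ultimately have "norm (integral {-R..R} (\<lambda>t. exp (\<i> * of_real (\<omega> * t)))) \<le> 1 / \<bar>\<omega>\<bar> + 1 / \<bar>\<omega>\<bar>"
        using norm_triangle_ineq4[of "G R" "G (-R)"] by simp
      then have "1 / (2 * R) * norm (integral {-R..R} (\<lambda>t. exp (\<i> * of_real (\<omega> * t)))) \<le> 1 / (2 * R) * (1 / \<bar>\<omega>\<bar> + 1 / \<bar>\<omega>\<bar>)"
        using elim by (intro mult_left_mono) auto
      then show ?case using elim by (simp add: field_simps)
    qed
  qed
qed

section \<open>Trigonometric polynomials and existence of their means\<close>

inductive trig_poly :: "(real \<Rightarrow> complex) \<Rightarrow> bool" where
  monomial: "trig_poly (\<lambda>t. c * exp (\<i> * of_real (\<omega> * t)))"
| add: "trig_poly f \<Longrightarrow> trig_poly g \<Longrightarrow> trig_poly (\<lambda>t. f t + g t)"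

lemma trig_poly_const: "trig_poly (\<lambda>_. c)"
  using trig_poly.monomial[of c 0] by simp

lemma trig_poly_sum: "(\<And>i. i \<in> I \<Longrightarrow> trig_poly (f i)) \<Longrightarrow> trig_poly (\<lambda>t. \<Sum>i\<in>I. f i t)"
  by (induction I rule: infinite_finite_induct) (auto intro: trig_poly_const trig_poly.add)

lemma trig_poly_mult:
  assumes "trig_poly f" "trig_poly g"
  shows "trig_poly (\<lambda>t. f t * g t)"
  using assms(1)
proof induction
  case (monomial c \<omega>)
  from assms(2) show ?case
  proof induction
    case (monomial d \<mu>)
    show ?case
      using trig_poly.monomial[of "c * d" "\<omega> + \<mu>"] by (simp add: algebra_simps exp_add)
  next
    case (add f g)
    then show ?case using trig_poly.add[OF add.IH] by (simp add: distrib_left)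
  qed
next
  case (add f1 f2)
  then show ?case using trig_poly.add[OF add.IH] by (simp add: distrib_right)
qed

lemma trig_poly_cnj: "trig_poly f \<Longrightarrow> trig_poly (\<lambda>t. cnj (f t))"
proof (induction rule: trig_poly.induct)
  case (monomial c \<omega>)
  show ?case using trig_poly.monomial[of "cnj c" "- \<omega>"] by (simp add: exp_cnj)
next
  case (add f g)
  then show ?case using trig_poly.add[OF add.IH] by simp
qed

lemma trig_poly_has_mean: "trig_poly f \<Longrightarrow> \<exists>L. has_mean f L"
proof (induction rule: trig_poly.induct)
  case (monomial c \<omega>)
  show ?case
  proof (cases "\<omega> = 0")
    case True
    then show ?thesis using has_mean_const[of c] by auto
  qed (use has_mean_cmult[OF has_mean_exp] in blast)
next
  case (add f g)
  then show ?case using has_mean_add by blast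
qed

lemma of_nat_powr_imaginary:
  assumes "n \<ge> 1"
  shows "of_nat n powr (\<i> * of_real t) = exp (\<i> * of_real (ln (real n) * t))"
  using assms by (simp add: powr_def Ln_of_nat mult_ac)

lemma trig_poly_dpoly: "trig_poly (\<lambda>t. dpoly a N (\<i> * of_real t))"
  unfolding dpoly_def
proof (rule trig_poly_sum)
  fix n assume "n \<in> {1..N}"
  then have n: "n \<ge> 1" by simp
  show "trig_poly (\<lambda>t. a n * of_nat n powr - (\<i> * of_real t))"
    using trig_poly.monomial[of "a n" "- ln (real n)"] of_nat_powr_imaginary[OF n, of "- t" for t] by simp
qed

text \<open>With \<open>f\<close> the polynomial on the imaginary axis, the function is
  \<open>x powr (p / 2)\<close> at \<open>x = (norm (f t))\<^sup>2\<close>. Weierstrass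
  approximation on \<open>{0..B\<^sup>2}\<close> makes it a uniform limit of trigonometric
  polynomials.\<close>

lemma has_mean_powr_dpoly:
  assumes "p > 0"
  shows "\<exists>L. has_mean (\<lambda>t. norm (dpoly a N (\<i> * of_real t)) powr p) L"
proof -
  define f where "f = (\<lambda>t. dpoly a N (\<i> * of_real t))"
  define B where "B = (\<Sum>n=1..N. norm (a n))"
  have B: "norm (f t) \<le> B" for t
    unfolding f_def B_def by (rule dpoly_bounded) simp
  have sq: "trig_poly (\<lambda>t. of_real ((norm (f t))\<^sup>2))"
    using trig_poly_mult[OF trig_poly_dpoly[of a N] trig_poly_cnj[OF trig_poly_dpoly[of a N]]]
    by (simp add: f_def complex_norm_square del: of_real_power)
  have "\<exists>L. has_mean (\<lambda>t. complex_of_real (norm (f t) powr p)) L"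
  proof (rule has_mean_exists_uniform_limit)
    fix e :: real assume "e > 0"
    have "continuous_on {0..B\<^sup>2} (\<lambda>x. x powr (p / 2))"
      using assms by (intro continuous_on_powr' continuous_intros) auto
    then obtain q where q: "real_polynomial_function q" "\<And>x. x \<in> {0..B\<^sup>2} \<Longrightarrow> \<bar>x powr (p / 2) - q x\<bar> < e"
      using Stone_Weierstrass_real_polynomial_function[OF compact_Icc _ \<open>e > 0\<close>] by blast
    from q(1) have "trig_poly (\<lambda>t. of_real (q ((norm (f t))\<^sup>2)))"
    proof (induction rule: real_polynomial_function.induct)
      case (linear h)
      then obtain c where "h = (\<lambda>x. x * c)" using real_bounded_linear by auto
      then show ?case using trig_poly_mult[OF sq trig_poly_const[of "of_real c"]] by simp
    next
      case (const c)
      show ?case by (rule trig_poly_const)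
    next
      case (add f g)
      then show ?case using trig_poly.add[OF add.IH] by simp
    next
      case (mult f g)
      then show ?case using trig_poly_mult[OF mult.IH] by simp
    qed
    then obtain M where "has_mean (\<lambda>t. complex_of_real (q ((norm (f t))\<^sup>2))) M"
      using trig_poly_has_mean by blast
    moreover have "norm (complex_of_real (norm (f t) powr p) - of_real (q ((norm (f t))\<^sup>2))) \<le> e" for t
    proof -
      have "((norm (f t))\<^sup>2) powr (p / 2) = norm (f t) powr p"
        by (simp add: powr_powr flip: powr_numeral)
      moreover have "(norm (f t))\<^sup>2 \<in> {0..B\<^sup>2}" using B[of t] by (simp add: power_mono)
      ultimately show ?thesis
        using q(2)[of "(norm (f t))\<^sup>2"] by (metis less_imp_le norm_of_real of_real_diff real_norm_def)
    qed
    ultimately show "\<exists>g M. has_mean g M \<and> (\<forall>t. norm (complex_of_real (norm (f t) powr p) - g t) \<le> e)"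
      by blast
  qed
  then obtain L where "has_mean (\<lambda>t. complex_of_real (norm (f t) powr p)) L" by blast
  from has_mean_linear[OF this bounded_linear_Re] show ?thesis by (auto simp: f_def)
qed

text \<open>On the imaginary axis the square is the real part of the majorant with
  \<open>\<theta> = 0\<close>. Its nonconstant terms have frequencies
  \<open>ln n - ln m \<noteq> 0\<close> and hence mean 0.\<close>

lemma has_mean_square_dpoly:
  "has_mean (\<lambda>t. (norm (dpoly a N (\<i> * of_real t)))\<^sup>2) (\<Sum>n=1..N. (norm (a n))\<^sup>2)"
proof -
  have "has_mean (\<lambda>t. majorant a N 0 (\<i> * of_real t)) (\<Sum>n=1..N. of_real ((norm (a n))\<^sup>2 * real n powr (- 2 * 0)) + 2 * (\<Sum>m\<in>{n<..N}. cnj (a n) * a m * of_real (real n powr (- 2 * 0)) * 0))"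
    unfolding majorant_altdef
  proof (intro has_mean_sum has_mean_add has_mean_const has_mean_cmult)
    fix n m assume nm: "n \<in> {1..N}" "m \<in> {n<..N}"
    then have "of_nat n powr (\<i> * of_real t) * of_nat m powr - (\<i> * of_real t) = exp (\<i> * of_real ((ln (real n) - ln (real m)) * t))" for t
      using of_nat_powr_imaginary[of n t] of_nat_powr_imaginary[of m "- t"] by (simp add: algebra_simps flip: exp_add)
    moreover have "ln (real n) - ln (real m) \<noteq> 0" using nm by simp
    ultimately show "has_mean (\<lambda>t. of_nat n powr (\<i> * of_real t) * of_nat m powr - (\<i> * of_real t)) 0"
      by (simp only: has_mean_exp not_False_eq_True)
  qed
  from has_mean_linear[OF this bounded_linear_Re]
  have "has_mean (\<lambda>t. Re (majorant a N 0 (\<i> * of_real t))) (Re (\<Sum>n=1..N. of_real ((norm (a n))\<^sup>2 * real n powr (- 2 * 0)) + 2 * (\<Sum>m\<in>{n<..N}. cnj (a n) * a m * of_real (real n powr (- 2 * 0)) * 0)))" .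
  also have "(\<lambda>t. Re (majorant a N 0 (\<i> * of_real t))) = (\<lambda>t. (norm (dpoly a N (\<i> * of_real t)))\<^sup>2)"
    by (intro ext dpoly_eq_majorant[symmetric]) simp
  also have "Re (\<Sum>n=1..N. of_real ((norm (a n))\<^sup>2 * real n powr (- 2 * 0)) + 2 * (\<Sum>m\<in>{n<..N}. cnj (a n) * a m * of_real (real n powr (- 2 * 0)) * 0)) = (\<Sum>n=1..N. (norm (a n))\<^sup>2)"
    unfolding Re_sum by (intro sum.cong) auto
  finally show ?thesis .
qed

section \<open>Membership in the Hardy spaces\<close>

text \<open>The error is at most the tail of the sum of coefficient norms, which does not involve
  \<open>s\<close>.\<close>

lemma drep_uniform_limit:
  assumes "drep 0 M c g"
  shows "\<exists>e. e \<longlonglongrightarrow> 0 \<and> (\<forall>K s. Re s \<ge> 0 \<longrightarrow> norm (g s - dpoly c K s) \<le> e K)"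
proof -
  obtain N where N: "((\<lambda>k. norm (c k) * real k powr - 0) has_sum N) UNIV"
    using assms unfolding drep_def by blast
  define e where "e = (\<lambda>K. N - (\<Sum>k=1..K. norm (c k)))"
  \<comment> \<open>Partial sums over \<open>k < Suc K\<close> agree with those over
    \<open>{1..K}\<close> because \<open>0 powr 0 = 0\<close>.\<close>
  have "(\<lambda>K. \<Sum>k<Suc K. norm (c k) * real k powr - 0) \<longlonglongrightarrow> N"
    using has_sum_imp_sums[OF N] unfolding sums_def by (rule LIMSEQ_Suc)
  also have "(\<lambda>K. \<Sum>k<Suc K. norm (c k) * real k powr - 0) = (\<lambda>K. \<Sum>k=1..K. norm (c k))"
    by (intro ext sum.mono_neutral_cong_right) auto
  finally have "e \<longlonglongrightarrow> 0"
    unfolding e_def using tendsto_diff[OF tendsto_const[of N]] by fastforce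
  moreover have "norm (g s - dpoly c K s) \<le> e K" if s: "Re s \<ge> 0" for K s
  proof -
    define h where "h = (\<lambda>k. if k \<in> {1..K} then c k * of_nat k powr - s else 0)"
    define h' where "h' = (\<lambda>k. if k \<in> {1..K} then norm (c k) * real k powr - 0 else 0)"
    have h: "(h has_sum dpoly c K s) UNIV"
      by (rule has_sum_finite_neutralI[of "{1..K}"]) (auto simp: h_def dpoly_def)
    have h': "(h' has_sum (\<Sum>k=1..K. norm (c k))) UNIV"
      by (rule has_sum_finite_neutralI[of "{1..K}"]) (auto simp: h'_def)
    show ?thesis
      unfolding e_def
    proof (rule norm_infsum_le[OF
          has_sum_add[OF drep_has_sum[OF assms s] has_sum_uminusI[OF h], folded diff_conv_add_uminus]
          has_sum_add[OF N has_sum_uminusI[OF h'], folded diff_conv_add_uminus]])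
      fix k
      show "norm (c k * of_nat k powr - s - h k) \<le> norm (c k) * real k powr - 0 - h' k"
        using powr_neg_mono[OF s, of k]
        by (auto simp: h_def h'_def norm_mult norm_of_nat_powr intro!: mult_left_le)
    qed
  qed
  ultimately show ?thesis by blast
qed

text \<open>The Parseval identity for partial sums passes to their uniform limit.\<close>

lemma has_mean_square_drep:
  assumes rep: "drep 0 M e H" and S: "\<And>K. (\<Sum>k=1..K. (norm (e k))\<^sup>2) \<le> S"
  shows "\<exists>L\<le>S. has_mean (\<lambda>t. (norm (H (\<i> * of_real t)))\<^sup>2) L"
proof -
  have "incseq (\<lambda>K. \<Sum>k=1..K. (norm (e k))\<^sup>2)"
    by (intro incseq_SucI) simp
  then obtain L where L: "(\<lambda>K. \<Sum>k=1..K. (norm (e k))\<^sup>2) \<longlonglongrightarrow> L"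
    using incseq_convergent S by blast
  obtain r where r: "r \<longlonglongrightarrow> 0" "\<And>K s. Re s \<ge> 0 \<Longrightarrow> norm (H s - dpoly e K s) \<le> r K"
    using drep_uniform_limit[OF rep] by blast
  have "has_mean (\<lambda>t. (norm (H (\<i> * of_real t)))\<^sup>2) L"
  proof (rule has_mean_uniform_limit[OF has_mean_square_dpoly L])
    \<comment> \<open>The bound comes from factoring \<open>x\<^sup>2 - y\<^sup>2\<close>, with
      \<open>x \<le> M\<close> and \<open>y \<le> M + r K\<close>.\<close>
    show "(\<lambda>K. r K * (2 * M + r K)) \<longlonglongrightarrow> 0"
      using tendsto_mult[OF r(1) tendsto_add[OF tendsto_const r(1)], of "2 * M"] by simp
    show "norm ((norm (H (\<i> * of_real t)))\<^sup>2 - (norm (dpoly e K (\<i> * of_real t)))\<^sup>2) \<le> r K * (2 * M + r K)" for K t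
    proof -
      define x where "x = norm (H (\<i> * of_real t))"
      define y where "y = norm (dpoly e K (\<i> * of_real t))"
      have xy: "\<bar>x - y\<bar> \<le> r K"
        unfolding x_def y_def using norm_triangle_ineq3 r(2)[of "\<i> * of_real t" K] order_trans by fastforce
      moreover have "x \<le> M" unfolding x_def by (rule drep_norm_le[OF rep]) simp
      moreover have "x \<ge> 0" "y \<ge> 0" by (simp_all add: x_def y_def)
      ultimately have "\<bar>x - y\<bar> * (x + y) \<le> r K * (2 * M + r K)"
        by (intro mult_mono) auto
      also have "\<bar>x - y\<bar> * (x + y) = \<bar>x\<^sup>2 - y\<^sup>2\<bar>"
        using \<open>x \<ge> 0\<close> \<open>y \<ge> 0\<close> by (simp add: power2_eq_square square_diff_square_factored abs_mult)
      finally show ?thesis by (simp add: x_def y_def)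
    qed
  qed
  moreover have "L \<le> S" by (rule LIMSEQ_le_const2[OF L]) (use S in blast)
  ultimately show ?thesis by blast
qed

section \<open>Smooth numbers and completely multiplicative weights\<close>

definition smooth_numbers :: "nat \<Rightarrow> nat set" where
  "smooth_numbers j = {n. n \<ge> 1 \<and> (\<forall>p. prime p \<longrightarrow> p dvd n \<longrightarrow> p \<le> j)}"

text \<open>The sum is a finite Euler product. When \<open>P = Suc j\<close> is prime, splitting off
  the power of \<open>P\<close> from \<open>n\<close> leaves a \<open>j\<close>-smooth factor and
  contributes a geometric series; otherwise the set does not grow.\<close>

lemma summable_on_smooth_numbers:
  assumes "x < 0"
  shows "(\<lambda>n. real n powr x) summable_on smooth_numbers j"
proof (induction j)
  case 0
  have "smooth_numbers 0 \<subseteq> {1}"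
    unfolding smooth_numbers_def using prime_factor_nat prime_gt_0_nat by fastforce
  then have "finite (smooth_numbers 0)" using finite_subset by blast
  then show ?case by simp
next
  case (Suc j)
  show ?case
  proof (cases "prime (Suc j)")
    case False
    then have "smooth_numbers (Suc j) = smooth_numbers j"
      unfolding smooth_numbers_def by (auto simp: le_Suc_eq)
    then show ?thesis using Suc by simp
  next
    case True
    define P where "P = Suc j"
    have P: "prime P" "P > 1" using True prime_gt_1_nat by (auto simp: P_def)
    define k where "k = (\<lambda>n. (multiplicity P n, n div P ^ multiplicity P n))"
    define F where "F = (\<lambda>q. (real P powr x) ^ fst q * real (snd q) powr x)"
    have decomp: "n = P ^ fst (k n) * snd (k n)" for n
      by (simp add: k_def multiplicity_dvd)
    have "real P powr x < 1" using assms P by (simp add: powr_less_one)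
    then have "(\<lambda>i. (real P powr x) ^ i) summable_on UNIV"
      by (intro summable_nonneg_imp_summable_on summable_geometric) auto
    then have F: "F summable_on (UNIV \<times> smooth_numbers j)"
      unfolding F_def by (rule summable_on_times[OF _ Suc]) auto
    have "k ` smooth_numbers (Suc j) \<subseteq> UNIV \<times> smooth_numbers j"
    proof
      fix q assume "q \<in> k ` smooth_numbers (Suc j)"
      then obtain n i m where n: "n \<in> smooth_numbers (Suc j)" "(i, m) = k n" and q: "q = (i, m)"
        by (metis imageE surj_pair)
      have nm: "n = P ^ i * m" using decomp[of n] n(2)[symmetric] by simp
      have n0: "n \<noteq> 0" using n by (auto simp: smooth_numbers_def)
      then have "m \<noteq> 0" using nm by auto
      have "\<not> P dvd m"
        using n(2) n0 P multiplicity_decompose[of n P] by (auto simp: k_def)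
      then have "p \<le> j" if "prime p" "p dvd m" for p
        using n(1) nm that by (auto simp: smooth_numbers_def P_def le_Suc_eq)
      then show "q \<in> UNIV \<times> smooth_numbers j" using \<open>m \<noteq> 0\<close> q by (auto simp: smooth_numbers_def)
    qed
    with F have "F summable_on k ` smooth_numbers (Suc j)" by (rule summable_on_subset_banach)
    moreover have "inj_on k (smooth_numbers (Suc j))"
      by (rule inj_onI) (metis decomp)
    ultimately have "(F \<circ> k) summable_on smooth_numbers (Suc j)"
      by (subst (asm) summable_on_reindex)
    also have "F \<circ> k = (\<lambda>n. real n powr x)"
    proof
      fix n
      have "real n powr x = real (P ^ fst (k n) * snd (k n)) powr x" using decomp[of n] by simp
      also have "\<dots> = F (k n)"
        using P by (simp add: F_def powr_mult powr_powr mult.commute flip: powr_realpow)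
      finally show "(F \<circ> k) n = real n powr x" by simp
    qed
    finally show ?thesis .
  qed
qed

text \<open>Multiplying the coefficients by completely multiplicative weights commutes with taking powers of a
  Dirichlet series, and these weights make it absolutely convergent on the line \<open>Re s = 0\<close>.\<close>

definition smooth_weight :: "nat \<Rightarrow> nat \<Rightarrow> real" where
  "smooth_weight j n = (if n \<in> smooth_numbers j then real n powr - (1 / real (Suc j)) else 0)"

text \<open>A product is smooth exactly when both factors are. The weight of 0 is 0, so zero factors
  are covered as well.\<close>

lemma smooth_weight_mult: "smooth_weight j (d * e) = smooth_weight j d * smooth_weight j e"
proof -
  have "d * e \<in> smooth_numbers j \<longleftrightarrow> d \<in> smooth_numbers j \<and> e \<in> smooth_numbers j"
    unfolding smooth_numbers_def by (auto simp: prime_dvd_mult_iff Suc_le_eq)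
  then show ?thesis by (auto simp: smooth_weight_def powr_mult)
qed

lemma smooth_weight_bounds: "smooth_weight j n \<ge> 0" "smooth_weight j n \<le> 1"
  using powr_mono[of "- (1 / real (Suc j))" 0 "real n"]
  by (auto simp: smooth_weight_def smooth_numbers_def)

lemma smooth_weight_1: "smooth_weight j 1 = 1"
  by (auto simp: smooth_weight_def smooth_numbers_def)

lemma smooth_weight_tendsto:
  assumes "n \<ge> 1"
  shows "(\<lambda>j. smooth_weight j n) \<longlonglongrightarrow> 1"
proof (rule Lim_transform_eventually)
  have "(\<lambda>j. real n powr - (1 / real (Suc j))) \<longlonglongrightarrow> real n powr - 0"
    using assms LIMSEQ_inverse_real_of_nat by (intro tendsto_intros) (auto simp: inverse_eq_divide)
  then show "(\<lambda>j. real n powr - (1 / real (Suc j))) \<longlonglongrightarrow> 1" using assms by simp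
  show "eventually (\<lambda>j. real n powr - (1 / real (Suc j)) = smooth_weight j n) sequentially"
    using eventually_ge_at_top[of n]
  proof eventually_elim
    case (elim j)
    then have "n \<in> smooth_numbers j"
      unfolding smooth_numbers_def using assms by (auto dest: dvd_imp_le)
    then show ?case by (simp add: smooth_weight_def)
  qed
qed

text \<open>The weight is constant on the index set \<open>d * e = k\<close> and factors out of the
  convolution. \<open>infsum_cmult_right'\<close> asks for no summability, so \<open>k = 0\<close>
  is included.\<close>

lemma cpow_smooth_weight:
  "cpow (\<lambda>n. of_real (smooth_weight j n) * c n) q k = of_real (smooth_weight j k) * cpow c q k"
proof (induction q arbitrary: k)
  case 0
  then show ?case using smooth_weight_1[of j] by auto
next
  case (Suc q)
  have "cpow (\<lambda>n. of_real (smooth_weight j n) * c n) (Suc q) k =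
     (\<Sum>\<^sub>\<infinity>(d, e)\<in>{(d, e). d * e = k}. of_real (smooth_weight j k) * (c d * cpow c q e))"
    unfolding cpow.simps conv_def Suc by (rule infsum_cong) (auto simp: smooth_weight_mult)
  also have "\<dots> = of_real (smooth_weight j k) * (\<Sum>\<^sub>\<infinity>(d, e)\<in>{(d, e). d * e = k}. c d * cpow c q e)"
    unfolding case_prod_unfold by (rule infsum_cmult_right')
  finally show ?case by (simp add: conv_def)
qed

text \<open>Bounded coefficients suffice: after weighting they are at most a multiple of a negative
  power of \<open>n\<close> on smooth numbers, and 0 elsewhere.\<close>

lemma drep_smooth_weight:
  assumes "\<And>n. norm (c n) \<le> B \<or> n = 0"
  shows "\<exists>M. drep 0 M (\<lambda>n. of_real (smooth_weight j n) * c n) (dseries (\<lambda>n. of_real (smooth_weight j n) * c n))"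
proof -
  have "(\<lambda>n. B * real n powr - (1 / real (Suc j))) summable_on smooth_numbers j"
    by (intro summable_on_cmult_right summable_on_smooth_numbers) simp
  then have "(\<lambda>n. norm (of_real (smooth_weight j n) * c n) * real n powr - 0) summable_on smooth_numbers j"
  proof (rule summable_on_comparison_test)
    fix n assume n: "n \<in> smooth_numbers j"
    then have "n \<noteq> 0" by (auto simp: smooth_numbers_def)
    then show "norm (of_real (smooth_weight j n) * c n) * real n powr - 0 \<le> B * real n powr - (1 / real (Suc j))"
      using assms[of n] n by (simp add: smooth_weight_def norm_mult mult.commute mult_left_mono)
  qed auto
  also have "?this \<longleftrightarrow> (\<lambda>n. norm (of_real (smooth_weight j n) * c n) * real n powr - 0) summable_on UNIV"
    by (rule summable_on_cong_neutral) (auto simp: smooth_weight_def)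
  finally have "(\<lambda>n. norm (of_real (smooth_weight j n) * c n) * real n powr - 0) summable_on UNIV" .
  then show ?thesis by (rule drep_dseries)
qed

section \<open>Norms of Dirichlet polynomials and interpolation\<close>

lemma dp_norm_eq:
  assumes "\<And>n. n > N \<Longrightarrow> a n = 0" "p > 0"
    and L: "has_mean (\<lambda>t. norm (dpoly a N (\<i> * of_real t)) powr p) L"
  shows "dp_norm p a = L powr (1 / p)"
proof -
  have "dseries a s = dpoly a N s" for s
  proof -
    have "dseries a s = (\<Sum>n<N. dterm a s n)"
      unfolding dseries_def by (rule suminf_finite) (auto simp: dterm_def assms)
    also have "\<dots> = dpoly a N s"
      unfolding dpoly_def dterm_def
      by (rule sum.reindex_bij_witness[of _ "\<lambda>n. n - 1" Suc]) auto
    finally show ?thesis .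
  qed
  then have eq: "(\<lambda>R. (1 / (2 * R) * integral {-R..R} (\<lambda>t. norm (dseries a (\<i> * of_real t)) powr p)) powr (1 / p)) =
      (\<lambda>R. ((1 / (2 * R)) *\<^sub>R integral {-R..R} (\<lambda>t. norm (dpoly a N (\<i> * of_real t)) powr p)) powr (1 / p))"
    by simp
  have "((\<lambda>R. ((1 / (2 * R)) *\<^sub>R integral {-R..R} (\<lambda>t. norm (dpoly a N (\<i> * of_real t)) powr p)) powr (1 / p)) \<longlongrightarrow> L powr (1 / p)) at_top"
  proof (rule tendsto_powr'[OF _ tendsto_const])
    show "((\<lambda>R. (1 / (2 * R)) *\<^sub>R integral {-R..R} (\<lambda>t. norm (dpoly a N (\<i> * of_real t)) powr p)) \<longlongrightarrow> L) at_top"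
      using L by (simp add: has_mean_def)
    have "eventually (\<lambda>R. 0 \<le> (1 / (2 * R)) *\<^sub>R integral {-R..R} (\<lambda>t. norm (dpoly a N (\<i> * of_real t)) powr p)) at_top"
      using eventually_gt_at_top[of 0]
      by eventually_elim (simp add: integral_nonneg[OF has_mean_integrable[OF L]])
    \<comment> \<open>If \<open>L = 0\<close>, continuity of the power at 0 requires a positive
      exponent and nonnegative averages.\<close>
    then show "L \<noteq> 0 \<or> 0 < 1 / p \<and> (\<forall>\<^sub>F R in at_top. 0 \<le> (1 / (2 * R)) *\<^sub>R integral {-R..R} (\<lambda>t. norm (dpoly a N (\<i> * of_real t)) powr p))"
      using assms by simp
  qed
  then show ?thesis
    unfolding dp_norm_def eq by (intro tendsto_Lim) auto
qed

text \<open>Write \<open>x powr p = x * y\<close> with \<open>y = x powr (p - 1)\<close> and apply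
  the arithmetic-geometric inequality with weight \<open>\<mu>\<close>. A large \<open>\<mu>\<close>
  makes the high power harmless, and the square is then small by mean-square convergence.\<close>

lemma powr_interpolation:
  fixes x \<mu> :: real
  assumes "x \<ge> 0" "p \<ge> 1" "\<mu> > 0" "real q \<ge> p - 1"
  shows "x powr p \<le> \<mu> * x\<^sup>2 + (1 + x ^ (2 * q)) / \<mu>"
proof (cases "x = 0")
  case True
  then show ?thesis using assms by (auto simp: add_nonneg_nonneg)
next
  case False
  then have x: "x > 0" using assms by simp
  define y where "y = x powr (p - 1)"
  have "x powr p = x * y" using x by (simp add: y_def powr_mult_base)
  also have "2 * (x * y) \<le> \<mu> * x\<^sup>2 + y\<^sup>2 / \<mu>"
  proof -
    have "(\<mu> * x - y)\<^sup>2 / \<mu> \<ge> 0" using assms by simp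
    then show ?thesis using assms by (simp add: power2_eq_square field_simps)
  qed
  moreover have "x * y \<ge> 0" using x by (simp add: y_def)
  moreover have "y\<^sup>2 \<le> 1 + x ^ (2 * q)"
  proof -
    have "y\<^sup>2 = x powr (2 * (p - 1))" using x by (simp add: y_def powr_powr mult.commute flip: powr_numeral)
    also have "\<dots> \<le> 1 + x powr (2 * real q)"
    proof (cases "x \<ge> 1")
      case True
      then have "x powr (2 * (p - 1)) \<le> x powr (2 * real q)" using assms by (intro powr_mono) auto
      then show ?thesis by simp
    next
      case False
      then have "x powr (2 * (p - 1)) \<le> 1" using x assms by (intro powr_le1) auto
      then show ?thesis by (simp add: add_increasing2)
    qed
    also have "x powr (2 * real q) = x ^ (2 * q)"
      using powr_realpow[OF x, of "2 * q"] by simp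
    finally show ?thesis .
  qed
  then have "y\<^sup>2 / \<mu> \<le> (1 + x ^ (2 * q)) / \<mu>" using assms by (simp add: divide_right_mono)
  ultimately show ?thesis by linarith
qed

lemma power_sum3_le:
  fixes x y :: real
  assumes "x \<ge> 0" "y \<ge> 0"
  shows "(x + y + 2) ^ r \<le> 4 ^ r * (x ^ r + y ^ r + 1)"
proof -
  \<comment> \<open>Then \<open>x + y + 2 \<le> 4 * m\<close>, while \<open>m ^ r\<close> is one of
    the three summands on the right.\<close>
  define m where "m = max x (max y 1)"
  have "m ^ r \<le> x ^ r + y ^ r + 1"
    using assms unfolding m_def max_def by (auto simp: add_nonneg_nonneg)
  then have "4 ^ r * m ^ r \<le> 4 ^ r * (x ^ r + y ^ r + 1)"
    by (rule mult_left_mono) simp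
  moreover have "(x + y + 2) ^ r \<le> (4 * m) ^ r"
    using assms by (intro power_mono) (auto simp: m_def)
  ultimately show ?thesis unfolding power_mult_distrib by (rule order_trans[rotated])
qed

text \<open>Dominated convergence for square sums: finitely many indices are settled by pointwise
  convergence, and beyond them the differences are bounded by the tail of \<open>c\<close>. The
  estimate is uniform in \<open>K\<close>.\<close>

lemma l2_dominated_tendsto:
  fixes c :: "nat \<Rightarrow> complex"
  assumes S: "\<And>K. (\<Sum>n=1..K. (norm (c n))\<^sup>2) \<le> S"
    and le: "\<And>j n. norm (P j n - c n) \<le> norm (c n)"
    and lim: "\<And>n. n \<ge> 1 \<Longrightarrow> (\<lambda>j. P j n) \<longlonglongrightarrow> c n"
    and "\<eta> > 0"
  shows "eventually (\<lambda>j. \<forall>K. (\<Sum>n=1..K. (norm (P j n - c n))\<^sup>2) \<le> \<eta>) sequentially"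
proof -
  define s where "s = (\<lambda>K. \<Sum>n=1..K. (norm (c n))\<^sup>2)"
  have inc: "incseq s" unfolding s_def by (intro incseq_SucI) simp
  then obtain L where L: "s \<longlonglongrightarrow> L" "\<And>K. s K \<le> L"
    using incseq_convergent[of s S] S by (auto simp: s_def)
  obtain N where N: "s N > L - \<eta> / 2"
    using order_tendstoD(1)[OF L(1), of "L - \<eta> / 2"] \<open>\<eta> > 0\<close>
    by (auto dest: eventually_happens'[OF sequentially_bot])
  have "(\<lambda>j. \<Sum>n=1..N. (norm (P j n - c n))\<^sup>2) \<longlonglongrightarrow> (\<Sum>n=1..N. (norm (c n - c n))\<^sup>2)"
    by (intro tendsto_intros lim) auto
  then have "(\<lambda>j. \<Sum>n=1..N. (norm (P j n - c n))\<^sup>2) \<longlonglongrightarrow> 0" by simp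
  from order_tendstoD(2)[OF this, of "\<eta> / 2"] \<open>\<eta> > 0\<close>
  have "eventually (\<lambda>j. (\<Sum>n=1..N. (norm (P j n - c n))\<^sup>2) < \<eta> / 2) sequentially" by simp
  then show ?thesis
  proof eventually_elim
    fix j assume j: "(\<Sum>n=1..N. (norm (P j n - c n))\<^sup>2) < \<eta> / 2"
    show "\<forall>K. (\<Sum>n=1..K. (norm (P j n - c n))\<^sup>2) \<le> \<eta>"
    proof
      fix K
      have "{1..max K N} = {1..N} \<union> {N<..max K N}" by auto
      then have split: "(\<Sum>n=1..max K N. f n) = (\<Sum>n=1..N. f n) + (\<Sum>n\<in>{N<..max K N}. f n)" for f :: "nat \<Rightarrow> real"
        by (simp add: sum.union_disjoint ivl_disj_int)
      have "(\<Sum>n=1..K. (norm (P j n - c n))\<^sup>2) \<le> (\<Sum>n=1..max K N. (norm (P j n - c n))\<^sup>2)"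
        by (rule sum_mono2) auto
      also have "\<dots> \<le> \<eta> / 2 + (\<Sum>n\<in>{N<..max K N}. (norm (c n))\<^sup>2)"
        unfolding split using j le by (intro add_mono sum_mono power_mono) auto
      also have "(\<Sum>n\<in>{N<..max K N}. (norm (c n))\<^sup>2) = s (max K N) - s N"
        unfolding s_def split by simp
      also have "\<dots> \<le> \<eta> / 2" using L(2)[of "max K N"] N by simp
      finally show "(\<Sum>n=1..K. (norm (P j n - c n))\<^sup>2) \<le> \<eta>" by simp
    qed
  qed
qed

text \<open>\<open>G ^ q\<close> has the weighted coefficients of \<open>cpow c q\<close>, and
  weights at most 1 do not increase the square sum. The bound \<open>S\<close> is therefore
  independent of \<open>j\<close>.\<close>

lemma has_mean_smooth_power:
  assumes S: "\<And>K. (\<Sum>k=1..K. (norm (cpow c q k))\<^sup>2) \<le> S"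
    and rep: "drep 0 M (\<lambda>n. of_real (smooth_weight j n) * c n) G"
  shows "\<exists>L\<le>S. has_mean (\<lambda>t. norm (G (\<i> * of_real t)) ^ (2 * q)) L"
proof -
  have "(\<Sum>k=1..K. (norm (cpow (\<lambda>n. of_real (smooth_weight j n) * c n) q k))\<^sup>2) \<le> S" for K
  proof (rule order_trans[OF sum_mono S])
    fix k
    have "smooth_weight j k * norm (cpow c q k) \<le> norm (cpow c q k)"
      using smooth_weight_bounds[of j k] by (intro mult_left_le_one_le) auto
    then show "(norm (cpow (\<lambda>n. of_real (smooth_weight j n) * c n) q k))\<^sup>2 \<le> (norm (cpow c q k))\<^sup>2"
      unfolding cpow_smooth_weight norm_mult norm_of_real using smooth_weight_bounds[of j k]
      by (intro power_mono) auto
  qed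
  from has_mean_square_drep[OF drep_cpow[OF rep] this]
  show ?thesis by (simp add: norm_power power_mult[symmetric] mult.commute)
qed

lemma hardyI:
  assumes S1: "\<And>K. (\<Sum>k=1..K. (norm (c k))\<^sup>2) \<le> S1"
    and pow: "\<And>q. \<exists>S. \<forall>K. (\<Sum>k=1..K. (norm (cpow c q k))\<^sup>2) \<le> S"
    and p: "p \<ge> 1"
  shows "c \<in> hardy p"
proof -
  have bd: "norm (c n) \<le> sqrt S1 \<or> n = 0" for n
  proof (cases "n = 0")
    case False
    have "(norm (c n))\<^sup>2 \<le> (\<Sum>k=1..n. (norm (c k))\<^sup>2)"
      using False by (intro member_le_sum) auto
    with S1[of n] have "(norm (c n))\<^sup>2 \<le> S1" by simp
    then show ?thesis by (simp add: real_le_rsqrt)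
  qed simp
  define w where "w = (\<lambda>j n. of_real (smooth_weight j n) * c n)"
  define G where "G = (\<lambda>j. dseries (w j))"
  have "\<exists>M. drep 0 M (w j) (G j)" for j
    unfolding w_def G_def by (rule drep_smooth_weight[OF bd])
  then obtain M where rep: "\<And>j. drep 0 (M j) (w j) (G j)" by metis
  \<comment> \<open>The crude error 1 is enough, since only boundedness in the high norm is at
    stake; \<open>N \<ge> j\<close> makes every fixed coefficient appear eventually.\<close>
  have "\<exists>N\<ge>j. \<forall>s. Re s \<ge> 0 \<longrightarrow> norm (G j s - dpoly (w j) N s) \<le> 1" for j
  proof -
    obtain e where e: "e \<longlonglongrightarrow> 0" "\<And>K s. Re s \<ge> 0 \<Longrightarrow> norm (G j s - dpoly (w j) K s) \<le> e K"
      using drep_uniform_limit[OF rep] by blast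
    have "eventually (\<lambda>N. e N < 1 \<and> N \<ge> j) sequentially"
      using order_tendstoD(2)[OF e(1), of 1] eventually_ge_at_top[of j] by (simp add: eventually_conj)
    then obtain N where "e N < 1" "N \<ge> j" using eventually_happens'[OF sequentially_bot] by blast
    with e(2) show ?thesis by (intro exI[of _ N]) (meson less_imp_le order_trans)
  qed
  then obtain N where N: "\<And>j. N j \<ge> j" "\<And>j s. Re s \<ge> 0 \<Longrightarrow> norm (G j s - dpoly (w j) (N j) s) \<le> 1"
    by metis
  define P where "P = (\<lambda>j n. if n \<in> {1..N j} then w j n else 0)"
  have dpP: "dpoly (P j) K s = dpoly (w j) (N j) s" if "K \<ge> N j" for j K s
    unfolding dpoly_def by (rule sum.mono_neutral_cong_right) (use that in \<open>auto simp: P_def\<close>)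
  define q where "q = nat \<lceil>p\<rceil>"
  have q: "real q \<ge> p - 1" unfolding q_def by linarith
  obtain S where S: "\<And>K. (\<Sum>k=1..K. (norm (cpow c q k))\<^sup>2) \<le> S" using pow[of q] by blast
  have S0: "S \<ge> 0" using S[of 0] by simp
  \<comment> \<open>\<open>Q\<close> is the bound that \<open>power_sum3_le\<close> yields once both
    high means are replaced by \<open>S\<close>.\<close>
  define Q where "Q = 4 ^ (2 * q) * (S + S + 1)"
  have Q0: "Q \<ge> 0" using S0 by (simp add: Q_def)
  have diff: "\<exists>L. 0 \<le> L \<and> dp_norm p (\<lambda>n. P j n - P k n) = L powr (1 / p) \<and>
      (\<forall>\<mu>>0. L \<le> \<mu> * (\<Sum>n=1..max (N j) (N k). (norm (P j n - P k n))\<^sup>2) + (1 + Q) / \<mu>)" for j k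
  proof -
    define K where "K = max (N j) (N k)"
    define g where "g = (\<lambda>t. dpoly (\<lambda>n. P j n - P k n) K (\<i> * of_real t))"
    obtain L where L: "has_mean (\<lambda>t. norm (g t) powr p) L"
      unfolding g_def using has_mean_powr_dpoly p by (metis less_le_trans zero_less_one)
    obtain Lj where Lj: "Lj \<le> S" "has_mean (\<lambda>t. norm (G j (\<i> * of_real t)) ^ (2 * q)) Lj"
      using has_mean_smooth_power[OF S rep[of j, unfolded w_def]] by blast
    obtain Lk where Lk: "Lk \<le> S" "has_mean (\<lambda>t. norm (G k (\<i> * of_real t)) ^ (2 * q)) Lk"
      using has_mean_smooth_power[OF S rep[of k, unfolded w_def]] by blast
    \<comment> \<open>The summand 2 inside \<open>power_sum3_le\<close> accounts for the two
      truncation errors, each at most 1.\<close>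
    have gle: "norm (g t) ^ (2 * q) \<le> 4 ^ (2 * q) * (norm (G j (\<i> * of_real t)) ^ (2 * q) + norm (G k (\<i> * of_real t)) ^ (2 * q) + 1)" for t
    proof -
      let ?s = "\<i> * of_real t"
      have "g t = dpoly (P j) K ?s - dpoly (P k) K ?s"
        by (simp add: g_def dpoly_def left_diff_distrib sum_subtractf)
      also have "\<dots> = dpoly (w j) (N j) ?s - dpoly (w k) (N k) ?s"
        by (simp add: dpP K_def)
      finally have "norm (g t) \<le> norm (dpoly (w j) (N j) ?s) + norm (dpoly (w k) (N k) ?s)"
        by (simp add: norm_triangle_ineq4)
      also have "\<dots> \<le> norm (G j ?s) + norm (G k ?s) + 2"
        using N(2)[of ?s j] N(2)[of ?s k]
          norm_triangle_ineq2[of "dpoly (w j) (N j) ?s" "G j ?s"] norm_triangle_ineq2[of "dpoly (w k) (N k) ?s" "G k ?s"]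
        by (simp add: norm_minus_commute)
      finally have "norm (g t) ^ (2 * q) \<le> (norm (G j ?s) + norm (G k ?s) + 2) ^ (2 * q)"
        by (rule power_mono) simp
      also have "\<dots> \<le> 4 ^ (2 * q) * (norm (G j ?s) ^ (2 * q) + norm (G k ?s) ^ (2 * q) + 1)"
        by (rule power_sum3_le) auto
      finally show ?thesis .
    qed
    have "L \<le> \<mu> * (\<Sum>n=1..K. (norm (P j n - P k n))\<^sup>2) + (1 + Q) / \<mu>" if \<mu>: "\<mu> > 0" for \<mu>
    proof -
      have "L \<le> \<mu> * (\<Sum>n=1..K. (norm (P j n - P k n))\<^sup>2) + 1 / \<mu> * (1 + 4 ^ (2 * q) * (Lj + Lk + 1))"
      proof (rule has_mean_mono[OF L])
        show "has_mean (\<lambda>t. \<mu> * (norm (g t))\<^sup>2 + 1 / \<mu> * (1 + 4 ^ (2 * q) * (norm (G j (\<i> * of_real t)) ^ (2 * q) + norm (G k (\<i> * of_real t)) ^ (2 * q) + 1)))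
          (\<mu> * (\<Sum>n=1..K. (norm (P j n - P k n))\<^sup>2) + 1 / \<mu> * (1 + 4 ^ (2 * q) * (Lj + Lk + 1)))"
          unfolding g_def by (intro has_mean_add has_mean_cmult has_mean_const has_mean_square_dpoly Lj(2) Lk(2))
        fix t
        have "norm (g t) powr p \<le> \<mu> * (norm (g t))\<^sup>2 + (1 + norm (g t) ^ (2 * q)) / \<mu>"
          by (rule powr_interpolation) (use p q \<mu> in auto)
        also have "\<dots> \<le> \<mu> * (norm (g t))\<^sup>2 + (1 + 4 ^ (2 * q) * (norm (G j (\<i> * of_real t)) ^ (2 * q) + norm (G k (\<i> * of_real t)) ^ (2 * q) + 1)) / \<mu>"
          using gle[of t] \<mu> by (intro add_left_mono divide_right_mono) auto
        finally show "norm (g t) powr p \<le> \<mu> * (norm (g t))\<^sup>2 + 1 / \<mu> * (1 + 4 ^ (2 * q) * (norm (G j (\<i> * of_real t)) ^ (2 * q) + norm (G k (\<i> * of_real t)) ^ (2 * q) + 1))"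
          by simp
      qed
      also have "1 / \<mu> * (1 + 4 ^ (2 * q) * (Lj + Lk + 1)) \<le> 1 / \<mu> * (1 + Q)"
        unfolding Q_def using Lj(1) Lk(1) \<mu> by (intro mult_left_mono add_left_mono add_right_mono add_mono) auto
      finally show ?thesis by simp
    qed
    moreover have "0 \<le> L" by (rule has_mean_mono[OF has_mean_const L]) simp
    moreover have "dp_norm p (\<lambda>n. P j n - P k n) = L powr (1 / p)"
      using L p unfolding g_def by (intro dp_norm_eq[of K]) (auto simp: P_def K_def)
    ultimately show ?thesis unfolding K_def by blast
  qed
  have lim: "(\<lambda>j. P j n) \<longlonglongrightarrow> c n" if n: "n \<ge> 1" for n
  proof (rule Lim_transform_eventually)
    show "(\<lambda>j. of_real (smooth_weight j n) * c n) \<longlonglongrightarrow> c n"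
      using tendsto_mult[OF tendsto_of_real[OF smooth_weight_tendsto[OF n]] tendsto_const[of "c n"]] by simp
    show "eventually (\<lambda>j. of_real (smooth_weight j n) * c n = P j n) sequentially"
      using eventually_ge_at_top[of n]
    proof eventually_elim
      case (elim j)
      then have "n \<in> {1..N j}" using N(1)[of j] n by simp
      then show ?case by (simp add: P_def w_def)
    qed
  qed
  have dom: "norm (P j n - c n) \<le> norm (c n)" for j n
  proof (cases "n \<in> {1..N j}")
    case True
    then have "P j n - c n = of_real (smooth_weight j n - 1) * c n"
      by (simp add: P_def w_def left_diff_distrib)
    then have "norm (P j n - c n) = \<bar>smooth_weight j n - 1\<bar> * norm (c n)"
      by (simp only: norm_mult norm_of_real)
    also have "\<dots> \<le> norm (c n)"
      using smooth_weight_bounds[of j n] by (intro mult_left_le_one_le) auto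
    finally show ?thesis .
  qed (auto simp: P_def)
  have cauchy: "\<exists>M. \<forall>j\<ge>M. \<forall>k\<ge>M. dp_norm p (\<lambda>n. P j n - P k n) < e" if e: "e > 0" for e
  proof -
    \<comment> \<open>The choices give \<open>(1 + Q) / \<mu> = e powr p / 4\<close> and
      \<open>\<mu> * (4 * \<eta>) = e powr p / 4\<close>, together less than
      \<open>e powr p\<close>.\<close>
    define \<mu> where "\<mu> = 4 * (1 + Q) / e powr p"
    define \<eta> where "\<eta> = e powr p / (16 * \<mu>)"
    have pos: "e powr p > 0" "\<mu> > 0" "\<eta> > 0" using e Q0 by (simp_all add: \<mu>_def \<eta>_def)
    obtain J where J: "\<And>j K. j \<ge> J \<Longrightarrow> (\<Sum>n=1..K. (norm (P j n - c n))\<^sup>2) \<le> \<eta>"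
      using l2_dominated_tendsto[of c S1 P, OF S1 dom lim pos(3)] unfolding eventually_sequentially by blast
    have "dp_norm p (\<lambda>n. P j n - P k n) < e" if jk: "j \<ge> J" "k \<ge> J" for j k
    proof -
      obtain L where L: "0 \<le> L" "dp_norm p (\<lambda>n. P j n - P k n) = L powr (1 / p)"
        "L \<le> \<mu> * (\<Sum>n=1..max (N j) (N k). (norm (P j n - P k n))\<^sup>2) + (1 + Q) / \<mu>"
        using diff pos by blast
      have "(\<Sum>n=1..max (N j) (N k). (norm (P j n - P k n))\<^sup>2) \<le>
        (\<Sum>n=1..max (N j) (N k). 2 * (norm (P j n - c n))\<^sup>2 + 2 * (norm (P k n - c n))\<^sup>2)"
      proof (rule sum_mono)
        fix n
        have "norm (P j n - P k n) \<le> norm (P j n - c n) + norm (P k n - c n)"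
          using norm_triangle_ineq4[of "P j n - c n" "P k n - c n"] by simp
        then have "(norm (P j n - P k n))\<^sup>2 \<le> (norm (P j n - c n) + norm (P k n - c n))\<^sup>2"
          by (rule power_mono) simp
        also have "\<dots> \<le> 2 * (norm (P j n - c n))\<^sup>2 + 2 * (norm (P k n - c n))\<^sup>2"
          using sum_squares_bound[of "norm (P j n - c n)" "norm (P k n - c n)"] by (simp add: power2_sum)
        finally show "(norm (P j n - P k n))\<^sup>2 \<le> 2 * (norm (P j n - c n))\<^sup>2 + 2 * (norm (P k n - c n))\<^sup>2" .
      qed
      also have "\<dots> = 2 * (\<Sum>n=1..max (N j) (N k). (norm (P j n - c n))\<^sup>2) + 2 * (\<Sum>n=1..max (N j) (N k). (norm (P k n - c n))\<^sup>2)"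
        by (simp add: sum.distrib sum_distrib_left)
      also have "\<dots> \<le> 4 * \<eta>"
        using J[OF jk(1), of "max (N j) (N k)"] J[OF jk(2), of "max (N j) (N k)"] by simp
      finally have "\<mu> * (\<Sum>n=1..max (N j) (N k). (norm (P j n - P k n))\<^sup>2) \<le> \<mu> * (4 * \<eta>)"
        using pos by (intro mult_left_mono) auto
      also have "\<mu> * (4 * \<eta>) = e powr p / 4" using pos by (simp add: \<eta>_def)
      finally have "L \<le> e powr p / 4 + (1 + Q) / \<mu>" using L(3) by simp
      also have "(1 + Q) / \<mu> = e powr p / 4"
        unfolding \<mu>_def using Q0 pos(1) by (subst divide_divide_eq_right) (simp add: divide_simps)
      finally have "L < e powr p" using pos(1) by linarith
      then have "L powr (1 / p) < (e powr p) powr (1 / p)"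
        using L(1) p by (intro powr_less_mono2) auto
      also have "\<dots> = e" using e p by (simp add: powr_powr)
      finally show ?thesis using L(2) by simp
    qed
    then show ?thesis by blast
  qed
  have "dirichlet_polynomial (P j)" for j
    unfolding dirichlet_polynomial_def by (rule finite_subset[of _ "{1..N j}"]) (auto simp: P_def)
  then show ?thesis
    unfolding hardy_def using cauchy lim by blast
qed

section \<open>The composition theorem\<close>

text \<open>Convergence at \<open>s\<close> bounds the terms there; moving right by 2 multiplies
  them by the summable factor \<open>real n powr - 2\<close>.\<close>

lemma convergent_dirichlet_drep:
  assumes "b \<in> convergent_dirichlet"
  shows "\<exists>\<sigma> B. drep \<sigma> B b (dseries b)"
proof -
  obtain s where s: "summable (dterm b s)" using assms by (auto simp: convergent_dirichlet_def)
  obtain C where C: "\<And>n. norm (dterm b s n) \<le> C"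
    using summable_imp_Bseq[OF s] by (auto simp: Bseq_def)
  have "(\<lambda>n. C * real n powr - 2) summable_on UNIV"
    by (intro summable_on_cmult_right summable_on_powr) simp
  then have "(\<lambda>n. norm (b n) * real n powr - (Re s + 2)) summable_on UNIV"
  proof (rule summable_on_comparison_test)
    fix n :: nat
    show "norm (b n) * real n powr - (Re s + 2) \<le> C * real n powr - 2"
    proof (cases n)
      case (Suc m)
      have "norm (b n) * real n powr - Re s \<le> C"
        using C[of m] Suc by (simp add: dterm_def norm_mult norm_of_nat_powr del: of_nat_Suc)
      then have "norm (b n) * real n powr - Re s * real n powr - 2 \<le> C * real n powr - 2"
        by (rule mult_right_mono) simp
      then show ?thesis by (simp add: mult.assoc flip: powr_add)
    qed simp
  qed auto
  from drep_dseries[OF this] show ?thesis by blast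
qed

lemma hardy_plus_partial_sums:
  assumes "a \<in> hardy_plus" "\<epsilon> > 0"
  shows "\<exists>S. \<forall>K. (\<Sum>n=1..K. (norm (a n))\<^sup>2 * real n powr (- 2 * \<epsilon>)) \<le> S"
proof -
  have "(\<lambda>n. (norm (a n))\<^sup>2 * real n powr (- 2 * \<epsilon>)) summable_on {1..}"
    using assms by (simp add: hardy_plus_iff)
  then have "(\<Sum>n=1..K. (norm (a n))\<^sup>2 * real n powr (- 2 * \<epsilon>)) \<le>
      (\<Sum>\<^sub>\<infinity>n\<in>{1..}. (norm (a n))\<^sup>2 * real n powr (- 2 * \<epsilon>))" for K
    by (rule finite_sum_le_infsum) auto
  then show ?thesis by blast
qed

theorem theorem4p5:
  fixes \<phi> :: "complex \<Rightarrow> complex" and c\<^sub>0 :: nat and b :: "nat \<Rightarrow> complex" and \<epsilon> :: real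
  assumes "c\<^sub>0 \<ge> 1"
    and "b \<in> convergent_dirichlet"
    and "\<phi> holomorphic_on half_plane 0"
    and "\<exists>\<sigma>\<ge>0. \<forall>s\<in>half_plane \<sigma>. \<phi> s = of_nat c\<^sub>0 * s + dseries b s"
    and "\<epsilon> > 0"
    and "\<phi> ` half_plane 0 \<subseteq> half_plane \<epsilon>"
  shows "\<forall>p::real. p \<ge> 1 \<longrightarrow> composition_maps_into \<phi> hardy_plus (hardy p)"
  unfolding composition_maps_into_def
proof (intro allI impI ballI)
  fix p :: real and a assume p: "p \<ge> 1" and a: "a \<in> hardy_plus"
  obtain \<sigma>\<^sub>1 B where b: "drep \<sigma>\<^sub>1 B b (dseries b)"
    using convergent_dirichlet_drep[OF assms(2)] by blast
  obtain \<sigma>\<^sub>2 where \<sigma>\<^sub>2: "\<And>s. Re s > \<sigma>\<^sub>2 \<Longrightarrow> \<phi> s = of_nat c\<^sub>0 * s + dseries b s"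
    using assms(4) by (auto simp: half_plane_def)
  \<comment> \<open>The entries secure absolute convergence of the series of \<open>b\<close>, the
    formula for \<open>\<phi>\<close>, and the two conditions of \<open>drep_compose\<close>.
    Together with \<open>lower\<close>, \<open>\<sigma> \<ge> B + 1\<close> also gives
    \<open>Re (\<phi> s) \<ge> 1\<close>.\<close>
  define \<sigma> where "\<sigma> = Max {\<sigma>\<^sub>1, \<sigma>\<^sub>2 + 1, B + 1, 0}"
  have \<sigma>: "\<sigma> \<ge> \<sigma>\<^sub>1" "\<sigma> > \<sigma>\<^sub>2" "\<sigma> \<ge> B + 1" "\<sigma> \<ge> 0"
    unfolding \<sigma>_def by (auto simp: max_def)
  have b: "drep \<sigma> B b (dseries b)" by (rule drep_mono[OF b \<sigma>(1) order_refl])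
  have \<phi>: "\<phi> s = of_nat c\<^sub>0 * s + dseries b s" if "Re s \<ge> \<sigma>" for s
    using \<sigma>\<^sub>2 that \<sigma> by simp
  have lower: "Re (\<phi> s) \<ge> Re s - B" if s: "Re s \<ge> \<sigma>" for s
  proof -
    have "1 * Re s \<le> real c\<^sub>0 * Re s" using assms(1) s \<sigma> by (intro mult_right_mono) auto
    moreover have "Re (dseries b s) \<ge> - B"
      using drep_norm_le[OF b s] abs_Re_le_cmod[of "dseries b s"] by linarith
    ultimately show ?thesis using \<phi>[OF s] by simp
  qed
  have "(\<lambda>n. norm (a n) * real n powr - 1) summable_on UNIV"
    by (rule hardy_plus_abs_summable[OF a])
  then obtain A where A: "drep 1 A a (dseries a)" using drep_dseries by blast
  obtain A' where A': "((\<lambda>n. norm (a n) * real n powr - 1) has_sum A') UNIV"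
    using has_sum_infsum[OF hardy_plus_abs_summable[OF a]] by blast
  obtain c where "drep \<sigma> A' c (\<lambda>s. \<Sum>\<^sub>\<infinity>n. a n * of_nat n powr - (of_nat c\<^sub>0 * s + dseries b s))"
    using drep_compose[OF b assms(1) \<sigma>(4,3) A'] by blast
  then have c: "drep \<sigma> A' c (\<lambda>s. dseries a (\<phi> s))"
  proof (rule drep_cong)
    fix s assume s: "Re s \<ge> \<sigma>"
    then have "Re (\<phi> s) \<ge> 1" using lower[OF s] \<sigma> by simp
    from infsumI[OF drep_has_sum[OF A this]]
    show "(\<Sum>\<^sub>\<infinity>n. a n * of_nat n powr - (of_nat c\<^sub>0 * s + dseries b s)) = dseries a (\<phi> s)"
      unfolding \<phi>[OF s] .
  qed
  have "composition_series \<phi> a c"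
    unfolding composition_series_def
  proof (intro exI[of _ \<sigma>] conjI ballI)
    fix s assume "s \<in> half_plane \<sigma>"
    then have s: "Re s \<ge> \<sigma>" by (simp add: half_plane_def)
    show "\<phi> s \<in> half_plane (1/2)" using lower[OF s] \<sigma> s by (simp add: half_plane_def)
    show "dterm c s sums dseries a (\<phi> s)" by (rule drep_sums[OF c s])
  qed (use \<sigma> in simp)
  moreover have "c \<in> hardy p"
  proof -
    note square = composition_square_summable[OF assms(3,6,5) lower]
    obtain S where "\<And>K. (\<Sum>n=1..K. (norm (a n))\<^sup>2 * real n powr (- 2 * \<epsilon>)) \<le> S"
      using hardy_plus_partial_sums[OF a assms(5)] by blast
    from square[OF _ A c this] have "(\<Sum>k=1..K. (norm (c k))\<^sup>2) \<le> S" for K .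
    \<comment> \<open>The same inequality is applied to the powers: \<open>cpow a q\<close> is again
      in \<open>hardy_plus\<close>, and \<open>cpow c q\<close> represents its composition with
      \<open>\<phi>\<close>.\<close>
    moreover have "\<exists>S. \<forall>K. (\<Sum>k=1..K. (norm (cpow c q k))\<^sup>2) \<le> S" for q
    proof -
      obtain S where "\<And>K. (\<Sum>n=1..K. (norm (cpow a q n))\<^sup>2 * real n powr (- 2 * \<epsilon>)) \<le> S"
        using hardy_plus_partial_sums[OF hardy_plus_cpow[OF a] assms(5)] by blast
      from square[OF _ drep_cpow[OF A] drep_cpow[OF c] this] show ?thesis by blast
    qed
    ultimately show ?thesis using p by (rule hardyI)
  qed
  ultimately show "\<exists>c\<in>hardy p. composition_series \<phi> a c" by blast
qed

end
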